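(* For any $k\ge 2$ and $k/2\ge d\ge 1$, with $t=\frac{1}{2x}$, $$I_{[k,d]}(x)=\frac{1}{x\,(U_d(t)-U_{d-1}(t))}\left[U_{d-1}(t)+\frac{U_{k-2d-1}(t)}{U_{k-d}(t)\,U_{k-d-1}(t)}\sum_{j=0}^{k-d-1}U_j(t)\right],$$ where $[k,d]$ denotes the permutation $(d+1,d+2,\dots,k,1,2,\dots,d)\in S_k$, $I_{[k,d]}(x)=\sum_{n\ge0}I_{[k,d]}(n)x^n$, and $I_{[k,d]}(n)$ is the number of involutions in $S_n$ avoiding both $132$ and $[k,d]$.
   Context: $S_n$ is the set of permutations of $\{1,\dots,n\}$. A permutation $\alpha\in S_n$ contains a pattern $\tau\in S_k$ if there are $1\le i_1<\dots<i_k\le n$ such that $(\alpha_{i_1},\dots,\alpha_{i_k})$ is order-isomorphic to $\tau$; otherwise $\alpha$ avoids $\tau$. An involution is a permutation equal to its own inverse; the empty permutation is counted for $n=0$. $U_r$ denotes the Chebyshev polynomial of the second kind, $U_r(\cos\theta)=\sin((r+1)\theta)/\sin\theta$; in particular $U_{-1}=0$. The identity is one of rational functions, expanded as power series in $x$. *)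

theory Defs
  imports Complex_Main
    "HOL-Computational_Algebra.Computational_Algebra"
    "HOL-Combinatorics.Permutations"
begin

section \<open>Pattern avoidance\<close>

text \<open>
  An element of \<open>S\<^sub>n\<close> is a function \<open>\<alpha>\<close> with \<open>\<alpha> permutes {1..n}\<close>; such a function is the
  identity outside \<open>{1..n}\<close>, so for \<open>n = 0\<close> there is exactly one, the empty permutation.
\<close>

definition contains_pattern :: "nat \<Rightarrow> (nat \<Rightarrow> nat) \<Rightarrow> nat \<Rightarrow> (nat \<Rightarrow> nat) \<Rightarrow> bool" where
  "contains_pattern n \<alpha> k \<tau> \<longleftrightarrow>
     (\<exists>i :: nat \<Rightarrow> nat. strict_mono_on {1..k} i \<and> i ` {1..k} \<subseteq> {1..n} \<and>
        (\<forall>a\<in>{1..k}. \<forall>b\<in>{1..k}. \<alpha> (i a) < \<alpha> (i b) \<longleftrightarrow> \<tau> a < \<tau> b))"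

abbreviation avoids_pattern :: "nat \<Rightarrow> (nat \<Rightarrow> nat) \<Rightarrow> nat \<Rightarrow> (nat \<Rightarrow> nat) \<Rightarrow> bool" where
  "avoids_pattern n \<alpha> k \<tau> \<equiv> \<not> contains_pattern n \<alpha> k \<tau>"

definition perm_132 :: "nat \<Rightarrow> nat" where
  "perm_132 = id(1 := 1, 2 := 3, 3 := 2)"

text \<open>The permutation \<open>[k,d] = (d+1, d+2, \<dots>, k, 1, 2, \<dots>, d)\<close> of \<open>{1..k}\<close>, for \<open>d \<le> k\<close>.\<close>

definition perm_kd :: "nat \<Rightarrow> nat \<Rightarrow> nat \<Rightarrow> nat" where
  "perm_kd k d j =
     (if 1 \<le> j \<and> j \<le> k - d then d + j
      else if k - d < j \<and> j \<le> k then j - (k - d)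
      else j)"

lemma perm_132_permutes: "perm_132 permutes {1..3}"
proof -
  have "perm_132 = transpose 2 3"
    by (auto simp: perm_132_def transpose_def fun_eq_iff)
  then show ?thesis
    using permutes_swap_id[of 2 "{1..3::nat}" 3] by simp
qed

lemma perm_kd_permutes:
  assumes "d \<le> k"
  shows "perm_kd k d permutes {1..k}"
proof (rule bij_imp_permutes)
  show "bij_betw (perm_kd k d) {1..k} {1..k}"
    by (rule bij_betw_byWitness[where f' = "\<lambda>m. if d < m then m - d else m + (k - d)"])
      (use assms in \<open>auto simp: perm_kd_def\<close>)
qed (auto simp: perm_kd_def)

lemma perm_kd_one_line:
  assumes "d \<le> k"
  shows "map (perm_kd k d) [1..<k+1] = [d+1..<k+1] @ [1..<d+1]"
  by (rule nth_equalityI) (use assms in \<open>auto simp: perm_kd_def nth_append simp del: upt_Suc\<close>)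

definition avoiding_involutions :: "nat \<Rightarrow> nat \<Rightarrow> nat \<Rightarrow> (nat \<Rightarrow> nat) set" where
  "avoiding_involutions k d n =
     {\<alpha>. \<alpha> permutes {1..n} \<and> inv \<alpha> = \<alpha> \<and>
         avoids_pattern n \<alpha> 3 perm_132 \<and> avoids_pattern n \<alpha> k (perm_kd k d)}"

lemma finite_avoiding_involutions: "finite (avoiding_involutions k d n)"
  by (rule finite_subset[OF _ finite_permutations[of "{1..n}"]])
    (auto simp: avoiding_involutions_def)

definition involution_gf :: "nat \<Rightarrow> nat \<Rightarrow> real fps" where
  "involution_gf k d = Abs_fps (\<lambda>n. of_nat (card (avoiding_involutions k d n)))"


section \<open>Chebyshev polynomials of the second kind\<close>

definition chebyshev_U :: "int \<Rightarrow> real poly" where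
  "chebyshev_U r =
     (THE p. \<forall>\<theta>. sin \<theta> \<noteq> 0 \<longrightarrow> poly p (cos \<theta>) = sin (of_int (r + 1) * \<theta>) / sin \<theta>)"

lemma chebyshev_U_unique:
  fixes p q :: "real poly"
  assumes p: "\<And>\<theta>. sin \<theta> \<noteq> 0 \<Longrightarrow> poly p (cos \<theta>) = f \<theta>"
    and q: "\<And>\<theta>. sin \<theta> \<noteq> 0 \<Longrightarrow> poly q (cos \<theta>) = f \<theta>"
  shows "p = q"
proof (rule ccontr)
  assume "p \<noteq> q"
  then have "finite {x. poly (p - q) x = 0}"
    by (intro poly_roots_finite) auto
  moreover have "{-1<..<1} \<subseteq> {x. poly (p - q) x = 0}"
  proof
    fix x :: real assume x: "x \<in> {-1<..<1}"
    then have "x\<^sup>2 < 1"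
      by (simp add: abs_square_less_1 abs_less_iff)
    then have "sin (arccos x) \<noteq> 0"
      using x by (simp add: sin_arccos)
    from p[OF this] q[OF this] x show "x \<in> {x. poly (p - q) x = 0}"
      by simp
  qed
  ultimately have "finite {-1<..<1::real}"
    by (rule rev_finite_subset)
  then show False
    using infinite_Ioo[of "-1" "1::real"] by simp
qed

lemma chebyshev_U_exists_nat:
  "\<exists>p :: real poly. \<forall>\<theta>. sin \<theta> \<noteq> 0 \<longrightarrow> poly p (cos \<theta>) = sin (real n * \<theta>) / sin \<theta>"
proof (induction n rule: less_induct)
  case (less n)
  consider "n = 0" | "n = 1" | m where "n = m + 2"
    by (metis One_nat_def add_2_eq_Suc' not0_implies_Suc)
  then show ?case
  proof cases
    case 1
    then show ?thesis by (intro exI[of _ 0]) simp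
  next
    case 2
    then show ?thesis by (intro exI[of _ 1]) simp
  next
    case (3 m)
    obtain p q :: "real poly"
      where p: "\<And>\<theta>. sin \<theta> \<noteq> 0 \<Longrightarrow> poly p (cos \<theta>) = sin (real m * \<theta>) / sin \<theta>"
        and q: "\<And>\<theta>. sin \<theta> \<noteq> 0 \<Longrightarrow> poly q (cos \<theta>) = sin (real (m + 1) * \<theta>) / sin \<theta>"
      using less.IH[of m] less.IH[of "m + 1"] 3 by auto
    have rec: "sin (real n * \<theta>) = 2 * cos \<theta> * sin (real (m + 1) * \<theta>) - sin (real m * \<theta>)" for \<theta>
    proof -
      have "real n * \<theta> = real (m + 1) * \<theta> + \<theta>" "real m * \<theta> = real (m + 1) * \<theta> - \<theta>"
        using 3 by (simp_all add: algebra_simps)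
      then show ?thesis
        by (simp only: sin_add sin_diff) (simp add: algebra_simps)
    qed
    have "poly ([:0, 2:] * q - p) (cos \<theta>) = sin (real n * \<theta>) / sin \<theta>" if "sin \<theta> \<noteq> 0" for \<theta>
      unfolding rec using p[OF that] q[OF that] by (simp add: diff_divide_distrib)
    then show ?thesis
      by blast
  qed
qed

lemma poly_chebyshev_U_cos:
  assumes "sin \<theta> \<noteq> 0"
  shows "poly (chebyshev_U r) (cos \<theta>) = sin (of_int (r + 1) * \<theta>) / sin \<theta>"
proof -
  let ?P = "\<lambda>p :: real poly. \<forall>\<theta>. sin \<theta> \<noteq> 0 \<longrightarrow> poly p (cos \<theta>) = sin (of_int (r + 1) * \<theta>) / sin \<theta>"
  have ex: "\<exists>p. ?P p"
  proof (cases "r + 1 \<ge> 0")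
    case True
    then show ?thesis
      using chebyshev_U_exists_nat[of "nat (r + 1)"] by simp
  next
    case False
    then obtain p :: "real poly" where "\<And>\<theta>. sin \<theta> \<noteq> 0 \<Longrightarrow>
        poly p (cos \<theta>) = sin (of_int (- (r + 1)) * \<theta>) / sin \<theta>"
      using chebyshev_U_exists_nat[of "nat (- (r + 1))"] by auto
    moreover have "sin (of_int (- (r + 1)) * \<theta>) = - sin (of_int (r + 1) * \<theta>)" for \<theta> :: real
      by (simp only: of_int_minus mult_minus_left sin_minus)
    ultimately show ?thesis
      by (intro exI[of _ "- p"]) simp
  qed
  then obtain p where p: "?P p" ..
  have "?P (chebyshev_U r)"
    unfolding chebyshev_U_def
  proof (rule theI)
    show "?P p" by (fact p)
    show "q = p" if "?P q" for q
      by (rule chebyshev_U_unique[where f = "\<lambda>\<theta>. sin (of_int (r + 1) * \<theta>) / sin \<theta>"])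
        (simp_all only: p that simp_thms)
  qed
  with assms show ?thesis by blast
qed

lemma chebyshev_U_minus_1: "chebyshev_U (-1) = 0"
  by (rule chebyshev_U_unique[OF poly_chebyshev_U_cos]) auto

lemma chebyshev_U_0: "chebyshev_U 0 = 1"
  by (rule chebyshev_U_unique[OF poly_chebyshev_U_cos]) auto

lemma chebyshev_U_rec: "chebyshev_U (r + 1) = [:0, 2:] * chebyshev_U r - chebyshev_U (r - 1)"
proof (rule chebyshev_U_unique[OF poly_chebyshev_U_cos])
  fix \<theta> :: real assume s: "sin \<theta> \<noteq> 0"
  have e: "of_int (r + 1 + 1) * \<theta> = of_int (r + 1) * \<theta> + \<theta>"
    "of_int (r - 1 + 1) * \<theta> = of_int (r + 1) * \<theta> - \<theta>"
    by (simp_all add: algebra_simps)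
  have "sin (of_int (r + 1 + 1) * \<theta>)
      = 2 * cos \<theta> * sin (of_int (r + 1) * \<theta>) - sin (of_int (r - 1 + 1) * \<theta>)"
    unfolding e sin_add sin_diff by (simp add: algebra_simps)
  then show "poly ([:0, 2:] * chebyshev_U r - chebyshev_U (r - 1)) (cos \<theta>)
      = sin (of_int (r + 1 + 1) * \<theta>) / sin \<theta>"
    using poly_chebyshev_U_cos[OF s, of r] poly_chebyshev_U_cos[OF s, of "r - 1"]
    by (simp add: diff_divide_distrib)
qed (assumption)

text \<open>
  \<open>U\<^sub>r(t)\<close> at a formal Laurent series \<open>t\<close>. At \<open>t = 1 / (2 x)\<close> this is a Laurent polynomial, and
  expanding rational functions of \<open>x\<close> at \<open>0\<close> means computing in the field \<^typ>\<open>real fls\<close>.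
\<close>

definition chebU :: "int \<Rightarrow> real fls \<Rightarrow> real fls" where
  "chebU r t = poly (map_poly fls_const (chebyshev_U r)) t"

end

theory Submission
  imports Defs
begin

text \<open>
  If a 132-avoiding permutation of size \<open>n\<close> has its maximum at position \<open>j\<close>, then everything up to
  position \<open>j\<close> lies above everything after it. For an involution with \<open>j < n\<close> this forces the
  skew sum \<open>(L, n) \<ominus> M \<ominus> (L\<inverse>, j)\<close> with \<open>L\<close> an arbitrary 132-avoiding permutation of size \<open>j - 1\<close>
  and \<open>M\<close> a 132-avoiding involution of size \<open>n - 2 j\<close>. Put \<open>p = k - d\<close>. Since \<open>[k,d]\<close> is the skew sum
  of increasing sequences of lengths \<open>p \<ge> d\<close> and \<open>d\<close>, such an involution avoids it iff \<open>L\<close> has no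
  increasing subsequence of length \<open>p - 1\<close> and either \<open>L\<close> has none of length \<open>d - 1\<close> and \<open>M\<close>
  avoids \<open>[k,d]\<close>, or \<open>L\<close> has one of length \<open>d - 1\<close> and \<open>M\<close> has none of length \<open>p\<close>. Writing \<open>F r\<close> and
  \<open>J r\<close> for the generating functions of the 132-avoiding permutations and involutions without an
  increasing subsequence of length \<open>r\<close>, one gets
  \<open>I = 1 + x I + x\<^sup>2 (F (d-1) (x\<^sup>2) I + (F (p-1) (x\<^sup>2) - F (d-1) (x\<^sup>2)) J p)\<close>,
  \<open>J (r+1) = 1 + x J r + x\<^sup>2 F r (x\<^sup>2) J (r+1)\<close> and \<open>F (r+1) = 1 + x F r F (r+1)\<close>.
  The last recurrence is the Chebyshev one: \<open>x F r (x\<^sup>2) = U (r-1) / U r\<close> at \<open>t = 1 / (2 x)\<close>.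
\<close>

section \<open>Patterns as increasing subsequences\<close>

definition has_132 :: "nat \<Rightarrow> (nat \<Rightarrow> nat) \<Rightarrow> bool" where
  "has_132 n \<alpha> \<longleftrightarrow> (\<exists>i j l. 1 \<le> i \<and> i < j \<and> j < l \<and> l \<le> n \<and> \<alpha> i < \<alpha> l \<and> \<alpha> l < \<alpha> j)"

text \<open>An increasing subsequence is recorded by its set of positions, so that restricting,
  shifting or joining subsequences becomes set algebra and no enumeration is carried along.\<close>

definition has_inc :: "nat \<Rightarrow> (nat \<Rightarrow> nat) \<Rightarrow> nat \<Rightarrow> bool" where
  "has_inc n \<alpha> r \<longleftrightarrow> (\<exists>S\<subseteq>{1..n}. card S = r \<and> strict_mono_on S \<alpha>)"

text \<open>This is the shape of \<open>[k,d]\<close> with \<open>p = k - d\<close>: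
  \<open>S\<close> holds the positions of the \<open>p\<close> large entries, \<open>T\<close> those
  of the \<open>d\<close> small entries that follow them.\<close>

definition has_inc_inc :: "nat \<Rightarrow> (nat \<Rightarrow> nat) \<Rightarrow> nat \<Rightarrow> nat \<Rightarrow> bool" where
  "has_inc_inc n \<alpha> p d \<longleftrightarrow>
     (\<exists>S\<subseteq>{1..n}. \<exists>T\<subseteq>{1..n}. card S = p \<and> card T = d \<and>
        strict_mono_on S \<alpha> \<and> strict_mono_on T \<alpha> \<and> (\<forall>s\<in>S. \<forall>t\<in>T. s < t \<and> \<alpha> t < \<alpha> s))"

lemma has_inc_incE:
  assumes "has_inc_inc n \<alpha> p d"
  obtains S T where "S \<subseteq> {1..n}" "card S = p" "strict_mono_on S \<alpha>"
    "T \<subseteq> {1..n}" "card T = d" "strict_mono_on T \<alpha>"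
    "\<forall>s\<in>S. \<forall>t\<in>T. s < t \<and> \<alpha> t < \<alpha> s"
proof -
  from assms obtain S T where "S \<subseteq> {1..n} \<and> T \<subseteq> {1..n} \<and> card S = p \<and> card T = d \<and>
        strict_mono_on S \<alpha> \<and> strict_mono_on T \<alpha> \<and> (\<forall>s\<in>S. \<forall>t\<in>T. s < t \<and> \<alpha> t < \<alpha> s)"
    unfolding has_inc_inc_def by (elim exE conjE) (rule that, intro conjI)
  then show thesis by (intro that[of S T]) simp_all
qed

lemma has_inc_incI:
  assumes "S \<subseteq> {1..n}" "card S = p" "strict_mono_on S \<alpha>"
    "T \<subseteq> {1..n}" "card T = d" "strict_mono_on T \<alpha>"
    "\<forall>s\<in>S. \<forall>t\<in>T. s < t \<and> \<alpha> t < \<alpha> s"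
  shows "has_inc_inc n \<alpha> p d"
  unfolding has_inc_inc_def using assms by (intro exI[of _ S] exI[of _ T] conjI)

lemma has_incI:
  assumes "S \<subseteq> {1..n}" "card S = r" "strict_mono_on S \<alpha>"
  shows "has_inc n \<alpha> r"
  unfolding has_inc_def using assms by (intro exI[of _ S] conjI)

lemma has_incE:
  assumes "has_inc n \<alpha> r"
  obtains S where "S \<subseteq> {1..n}" "card S = r" "strict_mono_on S \<alpha>"
  using assms unfolding has_inc_def by (elim exE conjE) (rule that)

section \<open>Translation of the two patterns\<close>

lemma contains_132_iff: "contains_pattern n \<alpha> 3 perm_132 \<longleftrightarrow> has_132 n \<alpha>"
proof
  assume "contains_pattern n \<alpha> 3 perm_132"
  then obtain i where i: "strict_mono_on {1..3} i" "i ` {1..3} \<subseteq> {1..n}"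
    and o: "\<And>a b. a \<in> {1..3} \<Longrightarrow> b \<in> {1..3} \<Longrightarrow> \<alpha> (i a) < \<alpha> (i b) \<longleftrightarrow> perm_132 a < perm_132 b"
    unfolding contains_pattern_def by metis
  have "i 1 < i 2" "i 2 < i 3" using strict_mono_onD[OF i(1), of 1 2] strict_mono_onD[OF i(1), of 2 3] by auto
  moreover have "1 \<le> i 1" "i 3 \<le> n" using i(2) by (simp_all add: image_subset_iff)
  moreover have "\<alpha> (i 1) < \<alpha> (i 3)" "\<alpha> (i 3) < \<alpha> (i 2)"
    by (simp_all add: o perm_132_def)
  ultimately show "has_132 n \<alpha>" unfolding has_132_def by blast
next
  assume "has_132 n \<alpha>"
  then obtain i j l where *: "1 \<le> i" "i < j" "j < l" "l \<le> n" "\<alpha> i < \<alpha> l" "\<alpha> l < \<alpha> j"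
    unfolding has_132_def by blast
  let ?h = "\<lambda>a::nat. if a = 1 then i else if a = 2 then j else l"
  have 3: "{1..3} = {1,2,3::nat}" by auto
  show "contains_pattern n \<alpha> 3 perm_132"
    unfolding contains_pattern_def 3
    by (rule exI[of _ ?h]) (use * in \<open>auto simp: perm_132_def intro!: strict_mono_onI\<close>)
qed

text \<open>Shifts an increasing enumeration indexed from 0 to one indexed from 1, the convention of
  \<open>contains_pattern\<close>.\<close>

lemma strict_mono_enum:
  fixes S :: "nat set"
  assumes "finite S" "card S = p"
  obtains f where "f ` {1..p} = S" "strict_mono_on {1..p} f"
proof -
  obtain h where h: "bij_betw h {..<card S} S" "strict_mono_on {..<card S} h"
    using ex_bij_betw_strict_mono_card[OF assms(1)] .
  have im: "(\<lambda>i. i - 1) ` {1..p} = {..<p}"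
    by (auto intro!: image_eqI[of _ _ "Suc _"])
  show thesis
  proof (rule that[of "\<lambda>i. h (i - 1)"])
    show "(\<lambda>i. h (i - 1)) ` {1..p} = S"
      using h(1) assms(2) im by (metis bij_betw_imp_surj_on image_image)
    show "strict_mono_on {1..p} (\<lambda>i. h (i - 1))"
      using assms(2) by (intro strict_mono_onI strict_mono_onD[OF h(2)]) auto
  qed
qed

text \<open>An embedding sends its first \<open>k - d\<close> indices to \<open>S\<close> and its
  last \<open>d\<close> to \<open>T\<close>. Conversely, the increasing enumerations of
  \<open>S\<close> and \<open>T\<close> are concatenated; the separation of \<open>S\<close> from
  \<open>T\<close> orders both positions and values across the seam.\<close>

lemma contains_kd_iff:
  assumes "d \<le> k"
  shows "contains_pattern n \<alpha> k (perm_kd k d) \<longleftrightarrow> has_inc_inc n \<alpha> (k - d) d"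
proof
  assume "contains_pattern n \<alpha> k (perm_kd k d)"
  then obtain i where i: "strict_mono_on {1..k} i" "i ` {1..k} \<subseteq> {1..n}"
    and o: "\<And>a b. a \<in> {1..k} \<Longrightarrow> b \<in> {1..k} \<Longrightarrow> \<alpha> (i a) < \<alpha> (i b) \<longleftrightarrow> perm_kd k d a < perm_kd k d b"
    unfolding contains_pattern_def by metis
  have inj: "inj_on i {1..k}" using i(1) by (rule strict_mono_on_imp_inj_on)
  have lt: "i a < i b \<longleftrightarrow> a < b" if "a \<in> {1..k}" "b \<in> {1..k}" for a b
    using strict_mono_on_less[OF i(1)] that by blast
  let ?S = "i ` {1..k-d}" and ?T = "i ` {k-d+1..k}"
  have "?S \<subseteq> {1..n}" "?T \<subseteq> {1..n}" using i(2) by (auto simp: image_subset_iff)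
  moreover have "card ?S = k - d" "card ?T = d"
    using assms by (auto intro!: trans[OF card_image[OF inj_on_subset[OF inj]]])
  moreover have "strict_mono_on ?S \<alpha>" "strict_mono_on ?T \<alpha>"
    by (rule strict_mono_onI, use assms in \<open>auto simp: lt o perm_kd_def\<close>)+
  moreover have "\<forall>s\<in>?S. \<forall>t\<in>?T. s < t \<and> \<alpha> t < \<alpha> s"
    using assms by (auto simp: lt o perm_kd_def)
  ultimately show "has_inc_inc n \<alpha> (k - d) d" unfolding has_inc_inc_def by blast
next
  assume "has_inc_inc n \<alpha> (k - d) d"
  then obtain S T where ST: "S \<subseteq> {1..n}" "card S = k - d" "strict_mono_on S \<alpha>"
    "T \<subseteq> {1..n}" "card T = d" "strict_mono_on T \<alpha>"
    and sep: "\<forall>s\<in>S. \<forall>t\<in>T. s < t \<and> \<alpha> t < \<alpha> s"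
    by (elim has_inc_incE) (rule that)
  obtain f where f: "f ` {1..k-d} = S" "strict_mono_on {1..k-d} f"
    using strict_mono_enum[OF finite_subset[OF ST(1) finite_atLeastAtMost] ST(2)] .
  obtain g where g: "g ` {1..d} = T" "strict_mono_on {1..d} g"
    using strict_mono_enum[OF finite_subset[OF ST(4) finite_atLeastAtMost] ST(5)] .
  define i where "i = (\<lambda>a. if a \<le> k - d then f a else g (a - (k - d)))"
  have iS: "i a \<in> S" if "1 \<le> a" "a \<le> k - d" for a using f(1) that by (auto simp: i_def)
  have iT: "i a \<in> T" if "k - d < a" "a \<le> k" for a
  proof -
    have "a - (k - d) \<in> {1..d}" using that by auto
    then show ?thesis using g(1) that by (auto simp: i_def simp del: atLeastAtMost_iff)
  qed
  \<comment> \<open>For \<open>a < b\<close> both directions of the comparison of values are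
    recorded, so that the equivalence for arbitrary indices follows by trichotomy.\<close>
  have less: "i a < i b \<and> (\<alpha> (i a) < \<alpha> (i b) \<longleftrightarrow> perm_kd k d a < perm_kd k d b) \<and>
      (\<alpha> (i b) < \<alpha> (i a) \<longleftrightarrow> perm_kd k d b < perm_kd k d a)"
    if ab: "a \<in> {1..k}" "b \<in> {1..k}" "a < b" for a b
  proof -
    consider "b \<le> k - d" | "a \<le> k - d" "k - d < b" | "k - d < a" using ab by linarith
    then show ?thesis
    proof cases
      case 1
      then have "i a < i b" using ab strict_mono_onD[OF f(2), of a b] by (auto simp: i_def)
      moreover have "\<alpha> (i a) < \<alpha> (i b)"
        using ab 1 by (intro strict_mono_onD[OF ST(3) iS iS calculation]) auto
      ultimately show ?thesis using 1 ab by (auto simp: perm_kd_def)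
    next
      case 2
      then show ?thesis using bspec[OF bspec[OF sep iS[of a]] iT[of b]] ab by (auto simp: perm_kd_def)
    next
      case 3
      then have "i a < i b" using ab strict_mono_onD[OF g(2), of "a - (k - d)" "b - (k - d)"] by (auto simp: i_def)
      moreover have "\<alpha> (i a) < \<alpha> (i b)"
        using ab 3 by (intro strict_mono_onD[OF ST(6) iT iT calculation]) auto
      ultimately show ?thesis using 3 ab by (auto simp: perm_kd_def)
    qed
  qed
  have "strict_mono_on {1..k} i" using less by (auto intro!: strict_mono_onI)
  moreover have "i ` {1..k} \<subseteq> {1..n}"
  proof (rule image_subsetI)
    fix a assume "a \<in> {1..k}"
    then show "i a \<in> {1..n}"
      using iS[of a] iT[of a] ST(1,4) by (cases "a \<le> k - d") auto
  qed
  moreover have "\<alpha> (i a) < \<alpha> (i b) \<longleftrightarrow> perm_kd k d a < perm_kd k d b"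
    if "a \<in> {1..k}" "b \<in> {1..k}" for a b
    using less[of a b] less[of b a] that by (cases a b rule: linorder_cases) auto
  ultimately show "contains_pattern n \<alpha> k (perm_kd k d)"
    unfolding contains_pattern_def by blast
qed

section \<open>Skew sums\<close>

text \<open>\<open>A\<close> is raised by \<open>b\<close> and stands before \<open>B\<close>. The
  last clause fixes 0 and every index past \<open>a + b\<close>, as \<open>permutes\<close>
  demands.\<close>

definition skew :: "nat \<Rightarrow> (nat \<Rightarrow> nat) \<Rightarrow> nat \<Rightarrow> (nat \<Rightarrow> nat) \<Rightarrow> nat \<Rightarrow> nat" where
  "skew a A b B i = (if 1 \<le> i \<and> i \<le> a then A i + b else if a < i \<and> i \<le> a + b then B (i - a) else i)"

lemma permutes_in_range:
  assumes "A permutes {1..n::nat}" "1 \<le> i" "i \<le> n"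
  shows "1 \<le> A i" "A i \<le> n"
  using permutes_in_image[OF assms(1), of i] assms(2,3) by auto

lemma permutes_outside:
  assumes "A permutes {1..n::nat}" "n < i"
  shows "A i = i"
  using assms by (simp add: permutes_not_in)

text \<open>Reflection in the diagonal inverts each block and exchanges their order.\<close>

lemma inv_skew_aux:
  assumes "A permutes {1..a}" "B permutes {1..b}"
  shows "skew b (inv B) a (inv A) (skew a A b B i) = i"
proof -
  consider "1 \<le> i" "i \<le> a" | "a < i" "i \<le> a + b" | "i = 0" | "a + b < i" by linarith
  then show ?thesis
  proof cases
    case 1
    then show ?thesis using permutes_in_range[OF assms(1), of i] permutes_inverses[OF assms(1)]
      by (simp add: skew_def)
  next
    case 2
    then show ?thesis using permutes_in_range[OF assms(2), of "i - a"] permutes_inverses[OF assms(2)]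
      by (simp add: skew_def)
  qed (auto simp: skew_def)
qed

lemma skew_left: "1 \<le> i \<Longrightarrow> i \<le> a \<Longrightarrow> skew a A b B i = A i + b"
  and skew_right: "a < i \<Longrightarrow> i \<le> a + b \<Longrightarrow> skew a A b B i = B (i - a)"
  by (simp_all add: skew_def)

lemma skew_descent:
  assumes "A permutes {1..a}" "B permutes {1..b}" "1 \<le> i" "i \<le> a" "a < t" "t \<le> a + b"
  shows "skew a A b B t < skew a A b B i"
proof -
  have "1 \<le> A i" using permutes_in_range(1)[OF assms(1,3,4)] .
  moreover have "B (t - a) \<le> b" using assms(5,6) by (intro permutes_in_range(2)[OF assms(2)]) auto
  ultimately show ?thesis using assms(3-) by (simp add: skew_left skew_right)
qed

lemma skew_in_range:
  assumes "A permutes {1..a}" "B permutes {1..b}" "i \<in> {1..a+b}"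
  shows "skew a A b B i \<in> {1..a + b}"
proof (cases "i \<le> a")
  case True
  then show ?thesis using permutes_in_range[OF assms(1), of i] assms(3) by (simp add: skew_left)
next
  case False
  then have "1 \<le> i - a" "i - a \<le> b" using assms(3) by auto
  from permutes_in_range[OF assms(2) this] False assms(3) show ?thesis by (simp add: skew_right)
qed

lemma skew_permutes:
  assumes "A permutes {1..a}" "B permutes {1..b}"
  shows "skew a A b B permutes {1..a + b}"
proof (rule bij_imp_permutes)
  have 1: "skew b (inv B) a (inv A) (skew a A b B i) = i" for i
    by (rule inv_skew_aux[OF assms])
  \<comment> \<open>The other side of the inverse law is the same fact applied to
    \<open>inv B\<close> and \<open>inv A\<close>.\<close>
  have 2: "skew a A b B (skew b (inv B) a (inv A) i) = i" for i
    using inv_skew_aux[OF permutes_inv[OF assms(2)] permutes_inv[OF assms(1)], of i]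
    unfolding permutes_inv_inv[OF assms(1)] permutes_inv_inv[OF assms(2)] .
  show "bij_betw (skew a A b B) {1..a + b} {1..a + b}"
  proof (rule bij_betw_byWitness[where f' = "skew b (inv B) a (inv A)"])
    show "skew a A b B ` {1..a + b} \<subseteq> {1..a + b}"
      using skew_in_range[OF assms] by (rule image_subsetI)
    show "skew b (inv B) a (inv A) ` {1..a + b} \<subseteq> {1..a + b}"
      using skew_in_range[OF permutes_inv[OF assms(2)] permutes_inv[OF assms(1)]]
      by (intro image_subsetI) (simp add: add.commute)
  qed (simp_all add: 1 2)
qed (auto simp: skew_def)

lemma inv_skew:
  assumes "A permutes {1..a}" "B permutes {1..b}"
  shows "inv (skew a A b B) = skew b (inv B) a (inv A)"
proof (rule inv_unique_comp)
  show "skew a A b B \<circ> skew b (inv B) a (inv A) = id"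
    using inv_skew_aux[OF permutes_inv[OF assms(2)] permutes_inv[OF assms(1)]]
    unfolding permutes_inv_inv[OF assms(1)] permutes_inv_inv[OF assms(2)] by (intro ext) simp
  show "skew b (inv B) a (inv A) \<circ> skew a A b B = id"
    using inv_skew_aux[OF assms] by (intro ext) simp
qed

text \<open>The inverse of a right-bracketed sum of three blocks comes out left-bracketed; this law
  makes the two comparable.\<close>

lemma skew_assoc: "skew (a + b) (skew a A b B) c C = skew a A (b + c) (skew b B c C)"
  by (rule ext) (auto simp: skew_def)

section \<open>Reading off the blocks of a skew sum\<close>

lemma skew_eqD:
  assumes "skew a A b B = skew a A' b B'" "A permutes {1..a}" "B permutes {1..b}"
    "A' permutes {1..a}" "B' permutes {1..b}"
  shows "A = A' \<and> B = B'"
proof (intro conjI ext)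
  fix i
  show "A i = A' i"
  proof (cases "1 \<le> i \<and> i \<le> a")
    case True
    then show ?thesis using fun_cong[OF assms(1), of i] by (simp add: skew_def)
  next
    case False
    then show ?thesis using assms(2,4) by (simp add: permutes_not_in)
  qed
  show "B i = B' i"
  proof (cases "1 \<le> i \<and> i \<le> b")
    case True
    then show ?thesis using fun_cong[OF assms(1), of "i + a"] by (simp add: skew_def)
  next
    case False
    then show ?thesis using assms(3,5) by (simp add: permutes_not_in)
  qed
qed

text \<open>Once the first \<open>a\<close> positions take the top \<open>a\<close> values, the
  remaining positions must take \<open>{1..b}\<close>; lowering the first block by \<open>b\<close>
  and shifting the positions of the second yields the two permutations.\<close>

lemma skew_decompose:
  fixes a b :: nat
  assumes \<alpha>: "\<alpha> permutes {1..a + b}" and im: "\<alpha> ` {1..a} = {b+1..a+b}"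
  obtains A B where "A permutes {1..a}" "B permutes {1..b}" "\<alpha> = skew a A b B"
proof -
  define A where "A = (\<lambda>i. if 1 \<le> i \<and> i \<le> a then \<alpha> i - b else i)"
  define B where "B = (\<lambda>i. if 1 \<le> i \<and> i \<le> b then \<alpha> (i + a) else i)"
  have inj: "inj \<alpha>" using \<alpha> by (rule permutes_inj)
  have lo: "\<alpha> i \<in> {b+1..a+b}" if "1 \<le> i" "i \<le> a" for i using im that by auto
  have "\<alpha> ` {a+1..a+b} = \<alpha> ` ({1..a+b} - {1..a})" by (rule arg_cong[of _ _ "image \<alpha>"]) auto
  also have "\<dots> = {1..a+b} - {b+1..a+b}"
    by (simp only: image_set_diff[OF inj] im permutes_image[OF \<alpha>])
  also have "\<dots> = {1..b}" by auto
  finally have im2: "\<alpha> ` {a+1..a+b} = {1..b}" .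
  have hi: "\<alpha> (i + a) \<in> {1..b}" if "1 \<le> i" "i \<le> b" for i
  proof -
    have "i + a \<in> {a+1..a+b}" using that by auto
    with im2 show ?thesis by blast
  qed
  have injA: "inj_on A {1..a}"
  proof (rule inj_onI)
    fix x y assume xy: "x \<in> {1..a}" "y \<in> {1..a}" "A x = A y"
    then have "\<alpha> x - b = \<alpha> y - b" by (simp add: A_def)
    moreover have "b < \<alpha> x" "b < \<alpha> y" using lo[of x] lo[of y] xy(1,2) by simp_all
    ultimately have "\<alpha> x = \<alpha> y" by simp
    then show "x = y" by (rule injD[OF inj])
  qed
  have injB: "inj_on B {1..b}"
  proof (rule inj_onI)
    fix x y assume "x \<in> {1..b}" "y \<in> {1..b}" "B x = B y"
    then have "\<alpha> (x + a) = \<alpha> (y + a)" by (simp add: B_def)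
    then have "x + a = y + a" by (rule injD[OF inj])
    then show "x = y" by simp
  qed
  have "A i \<in> {1..a}" if "i \<in> {1..a}" for i
    using lo[of i] that by (auto simp: A_def)
  then have "A ` {1..a} \<subseteq> {1..a}" by (rule image_subsetI)
  then have A: "A permutes {1..a}"
    using injA endo_inj_surj[of "{1..a}" A]
    by (intro bij_imp_permutes) (simp add: bij_betw_def, metis A_def atLeastAtMost_iff)
  have "B i \<in> {1..b}" if "i \<in> {1..b}" for i
    using hi[of i] that by (auto simp: B_def)
  then have "B ` {1..b} \<subseteq> {1..b}" by (rule image_subsetI)
  then have B: "B permutes {1..b}"
    using injB endo_inj_surj[of "{1..b}" B]
    by (intro bij_imp_permutes) (simp add: bij_betw_def, metis B_def atLeastAtMost_iff)
  have "\<alpha> = skew a A b B"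
  proof
    fix i
    show "\<alpha> i = skew a A b B i"
      using lo[of i] permutes_not_in[OF \<alpha>, of i] by (auto simp: skew_def A_def B_def)
  qed
  with A B show thesis by (rule that)
qed

text \<open>Each of the first \<open>a\<close> values exceeds the \<open>b\<close> distinct positive
  values after position \<open>a\<close>, hence exceeds \<open>b\<close>. Equal cardinalities turn
  the inclusion into equality.\<close>

lemma image_prefix_if_descent:
  fixes a b :: nat
  assumes \<alpha>: "\<alpha> permutes {1..a + b}"
    and desc: "\<And>i l. 1 \<le> i \<Longrightarrow> i \<le> a \<Longrightarrow> a < l \<Longrightarrow> l \<le> a + b \<Longrightarrow> \<alpha> l < \<alpha> i"
  shows "\<alpha> ` {1..a} = {b+1..a+b}"
proof (rule card_subset_eq)
  have inj: "inj \<alpha>" using \<alpha> by (rule permutes_inj)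
  show "\<alpha> ` {1..a} \<subseteq> {b+1..a+b}"
  proof
    fix y assume "y \<in> \<alpha> ` {1..a}"
    then obtain i where i: "1 \<le> i" "i \<le> a" "y = \<alpha> i" by auto
    have "\<alpha> ` {a+1..a+b} \<subseteq> {1..<\<alpha> i}"
    proof (rule image_subsetI)
      fix l assume "l \<in> {a+1..a+b}"
      then show "\<alpha> l \<in> {1..<\<alpha> i}"
        using desc[OF i(1,2), of l] permutes_in_range(1)[OF \<alpha>, of l] by simp
    qed
    from card_mono[OF _ this] have "b \<le> \<alpha> i - 1"
      by (simp add: card_image inj_on_subset[OF inj])
    then show "y \<in> {b+1..a+b}" using permutes_in_range[OF \<alpha>, of i] i by auto
  qed
  show "card (\<alpha> ` {1..a}) = card {b+1..a+b}"
    by (simp add: card_image inj_on_subset[OF inj])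
qed simp

section \<open>Patterns in skew sums\<close>

lemma has_132_skew:
  assumes "A permutes {1..a}" "B permutes {1..b}"
  shows "has_132 (a + b) (skew a A b B) \<longleftrightarrow> has_132 a A \<or> has_132 b B"
proof
  assume "has_132 (a + b) (skew a A b B)"
  then obtain i j l where *: "1 \<le> i" "i < j" "j < l" "l \<le> a + b"
    "skew a A b B i < skew a A b B l" "skew a A b B l < skew a A b B j"
    unfolding has_132_def by (elim exE conjE) (rule that)
  \<comment> \<open>An occurrence cannot straddle the blocks: its last entry exceeds its first,
    whereas the second block lies below the first one.\<close>
  have "l \<le> a" if "i \<le> a"
    using that * skew_descent[OF assms, of i l] by linarith
  then consider "l \<le> a" | "a < i" by linarith
  then show "has_132 a A \<or> has_132 b B"
  proof cases
    case 1
    then have "has_132 a A" unfolding has_132_def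
      by (intro exI[of _ i] exI[of _ j] exI[of _ l]) (use * in \<open>auto simp: skew_def\<close>)
    then show ?thesis ..
  next
    case 2
    then have "has_132 b B" unfolding has_132_def
      by (intro exI[of _ "i - a"] exI[of _ "j - a"] exI[of _ "l - a"])
        (use * in \<open>auto simp: skew_def\<close>)
    then show ?thesis ..
  qed
next
  assume "has_132 a A \<or> has_132 b B"
  then show "has_132 (a + b) (skew a A b B)"
  proof
    assume "has_132 a A"
    then obtain i j l where "1 \<le> i" "i < j" "j < l" "l \<le> a" "A i < A l" "A l < A j"
      unfolding has_132_def by (elim exE conjE) (rule that)
    then show ?thesis unfolding has_132_def
      by (intro exI[of _ i] exI[of _ j] exI[of _ l]) (auto simp: skew_def)
  next
    assume "has_132 b B"
    then obtain i j l where "1 \<le> i" "i < j" "j < l" "l \<le> b" "B i < B l" "B l < B j"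
      unfolding has_132_def by (elim exE conjE) (rule that)
    then show ?thesis unfolding has_132_def
      by (intro exI[of _ "i + a"] exI[of _ "j + a"] exI[of _ "l + a"]) (auto simp: skew_def)
  qed
qed

lemma strict_mono_on_skew_left:
  assumes "S \<subseteq> {1..a}"
  shows "strict_mono_on S (skew a A b B) \<longleftrightarrow> strict_mono_on S A"
proof -
  have "skew a A b B i = A i + b" if "i \<in> S" for i
    using that assms by (intro skew_left) auto
  then show ?thesis by (simp add: monotone_on_def)
qed

lemma strict_mono_on_skew_right:
  assumes "S \<subseteq> {1..b}"
  shows "strict_mono_on ((+) a ` S) (skew a A b B) \<longleftrightarrow> strict_mono_on S B"
proof -
  have "skew a A b B (a + i) = B i" if "i \<in> S" for i
    using skew_right[of a "a + i" b A B] that assms by auto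
  then show ?thesis by (simp add: monotone_on_def)
qed

text \<open>Passing from the first block to the second is a descent, so an increasing subsequence
  stays within one block. The empty set falls under \<open>left\<close>.\<close>

lemma strict_mono_on_skew_cases:
  assumes "A permutes {1..a}" "B permutes {1..b}"
    and S: "S \<subseteq> {1..a+b}" and m: "strict_mono_on S (skew a A b B)"
  obtains (left) "S \<subseteq> {1..a}" "strict_mono_on S A"
  | (right) S' where "S' \<subseteq> {1..b}" "S = (+) a ` S'" "card S' = card S" "strict_mono_on S' B"
proof (cases "S \<subseteq> {1..a}")
  case True
  show thesis
    by (rule left[OF True]) (use m strict_mono_on_skew_left[OF True] in blast)
next
  case False
  then obtain t where t: "t \<in> S" "t \<notin> {1..a}" by (auto simp: subset_iff)
  with S have t': "a < t" "t \<le> a + b" by auto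
  have gt: "a < s" if "s \<in> S" for s
  proof (rule ccontr)
    assume "\<not> a < s"
    moreover have "1 \<le> s" using S that by auto
    ultimately show False
      using strict_mono_onD[OF m that t(1)] t' skew_descent[OF assms(1,2), of s t] by linarith
  qed
  let ?S = "(\<lambda>i. i - a) ` S"
  have sub: "?S \<subseteq> {1..b}"
  proof (rule image_subsetI)
    fix i assume "i \<in> S"
    then show "i - a \<in> {1..b}" using gt[of i] S by auto
  qed
  have "(\<lambda>i. a + (i - a)) ` S = (\<lambda>i. i) ` S"
    by (rule image_cong) (use gt in \<open>simp_all add: less_imp_le\<close>)
  then have eq: "S = (+) a ` ?S" by (simp add: image_image)
  have "card ((+) a ` ?S) = card ?S" by (rule card_image) simp
  then have card: "card ?S = card S" using eq by simp
  have "strict_mono_on ((+) a ` ?S) (skew a A b B)" using m eq by simp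
  then have "strict_mono_on ?S B" using strict_mono_on_skew_right[OF sub] by blast
  with sub eq card show thesis by (rule right)
qed

lemma has_inc_skew_left:
  assumes "has_inc a A r"
  shows "has_inc (a + b) (skew a A b B) r"
proof -
  from assms obtain S where S: "S \<subseteq> {1..a}" "card S = r" "strict_mono_on S A"
    by (elim has_incE) (rule that)
  show ?thesis
    by (rule has_incI[of S]) (use S in \<open>auto simp: strict_mono_on_skew_left\<close>)
qed

lemma has_inc_skew_right:
  assumes "has_inc b B r"
  shows "has_inc (a + b) (skew a A b B) r"
proof -
  from assms obtain S where S: "S \<subseteq> {1..b}" "card S = r" "strict_mono_on S B"
    by (elim has_incE) (rule that)
  show ?thesis
    by (rule has_incI[of "(+) a ` S"])
      (use S in \<open>auto simp: strict_mono_on_skew_right card_image\<close>)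
qed

lemma has_inc_skew:
  assumes "A permutes {1..a}" "B permutes {1..b}"
  shows "has_inc (a + b) (skew a A b B) r \<longleftrightarrow> has_inc a A r \<or> has_inc b B r"
proof
  assume "has_inc (a + b) (skew a A b B) r"
  then obtain S where S: "S \<subseteq> {1..a+b}" "card S = r" "strict_mono_on S (skew a A b B)"
    by (elim has_incE) (rule that)
  show "has_inc a A r \<or> has_inc b B r"
  proof (rule strict_mono_on_skew_cases[OF assms S(1,3)])
    assume "S \<subseteq> {1..a}" "strict_mono_on S A"
    then have "has_inc a A r" using S(2) by (intro has_incI[of S])
    then show ?thesis ..
  next
    fix S' assume "S' \<subseteq> {1..b}" "card S' = card S" "strict_mono_on S' B"
    then have "has_inc b B r" using S(2) by (intro has_incI[of S']) simp_all
    then show ?thesis ..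
  qed
qed (use has_inc_skew_left has_inc_skew_right in blast)

text \<open>Each of the two increasing parts lies in a single block, and the lower part cannot stand
  in an earlier block than the upper part. The bounds \<open>p \<ge> 1\<close> and
  \<open>d \<ge> 1\<close> supply the two elements that rule this out.\<close>

lemma has_inc_inc_skew:
  assumes "A permutes {1..a}" "B permutes {1..b}" "p \<ge> 1" "d \<ge> 1"
  shows "has_inc_inc (a + b) (skew a A b B) p d \<longleftrightarrow>
    has_inc_inc a A p d \<or> has_inc_inc b B p d \<or> has_inc a A p \<and> has_inc b B d"
proof
  assume "has_inc_inc (a + b) (skew a A b B) p d"
  then obtain S T where S: "S \<subseteq> {1..a+b}" "card S = p" "strict_mono_on S (skew a A b B)"
    and T: "T \<subseteq> {1..a+b}" "card T = d" "strict_mono_on T (skew a A b B)"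
    and sep: "\<forall>s\<in>S. \<forall>t\<in>T. s < t \<and> skew a A b B t < skew a A b B s"
    by (elim has_inc_incE) (rule that)
  show "has_inc_inc a A p d \<or> has_inc_inc b B p d \<or> has_inc a A p \<and> has_inc b B d"
  \<comment> \<open>The four cases place \<open>S\<close> and \<open>T\<close> in the order
    left-left, left-right, right-left, right-right.\<close>
  proof (rule strict_mono_on_skew_cases[OF assms(1,2) S(1,3)];
      rule strict_mono_on_skew_cases[OF assms(1,2) T(1,3)])
    assume *: "S \<subseteq> {1..a}" "strict_mono_on S A" "T \<subseteq> {1..a}" "strict_mono_on T A"
    have "s < t \<and> A t < A s" if "s \<in> S" "t \<in> T" for s t
    proof -
      have "s \<in> {1..a}" "t \<in> {1..a}" using that *(1,3) by auto
      then have "skew a A b B s = A s + b" "skew a A b B t = A t + b" by (simp_all add: skew_left)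
      then show ?thesis
        using bspec[OF bspec[OF sep that(1)] that(2)] by simp
    qed
    then have "has_inc_inc a A p d"
      using * S(2) T(2) by (intro has_inc_incI[of S _ _ _ T]) auto
    then show ?thesis ..
  next
    fix T' assume *: "S \<subseteq> {1..a}" "strict_mono_on S A"
      "T' \<subseteq> {1..b}" "card T' = card T" "strict_mono_on T' B"
    have "has_inc a A p" using * S(2) by (intro has_incI[of S])
    moreover have "has_inc b B d" using * T(2) by (intro has_incI[of T']) simp_all
    ultimately show ?thesis by simp
  next
    fix S' assume *: "S = (+) a ` S'" "S' \<subseteq> {1..b}" "T \<subseteq> {1..a}"
    have "S \<noteq> {}" "T \<noteq> {}" using S(2) T(2) assms(3,4) by auto
    then obtain s t where st: "s \<in> S" "t \<in> T" by blast
    then have "a < s" "t \<le> a" using * by auto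
    then have False using bspec[OF bspec[OF sep st(1)] st(2)] by simp
    then show ?thesis ..
  next
    fix S' T' assume *: "S' \<subseteq> {1..b}" "S = (+) a ` S'" "card S' = card S" "strict_mono_on S' B"
      "T' \<subseteq> {1..b}" "T = (+) a ` T'" "card T' = card T" "strict_mono_on T' B"
    have "s < t \<and> B t < B s" if "s \<in> S'" "t \<in> T'" for s t
    proof -
      have "s \<in> {1..b}" "t \<in> {1..b}" and st: "a + s \<in> S" "a + t \<in> T"
        using that *(1,2,5,6) by auto
      then have "skew a A b B (a + s) = B s" "skew a A b B (a + t) = B t" by (simp_all add: skew_right)
      then show ?thesis using bspec[OF bspec[OF sep st(1)] st(2)] by simp
    qed
    then have "has_inc_inc b B p d"
      using * S(2) T(2) by (intro has_inc_incI[of S' _ _ _ T']) auto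
    then show ?thesis by simp
  qed
next
  assume "has_inc_inc a A p d \<or> has_inc_inc b B p d \<or> has_inc a A p \<and> has_inc b B d"
  then show "has_inc_inc (a + b) (skew a A b B) p d"
  proof (elim disjE conjE)
    assume "has_inc_inc a A p d"
    then obtain S T where S: "S \<subseteq> {1..a}" "card S = p" "strict_mono_on S A"
      and T: "T \<subseteq> {1..a}" "card T = d" "strict_mono_on T A"
      and sep: "\<forall>s\<in>S. \<forall>t\<in>T. s < t \<and> A t < A s"
      by (elim has_inc_incE) (rule that)
    have "\<forall>s\<in>S. \<forall>t\<in>T. s < t \<and> skew a A b B t < skew a A b B s"
    proof (intro ballI)
      fix s t assume st: "s \<in> S" "t \<in> T"
      then have "s \<in> {1..a}" "t \<in> {1..a}" using S(1) T(1) by auto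
      then have "skew a A b B s = A s + b" "skew a A b B t = A t + b" by (simp_all add: skew_left)
      then show "s < t \<and> skew a A b B t < skew a A b B s"
        using bspec[OF bspec[OF sep st(1)] st(2)] by simp
    qed
    then show ?thesis
      by (intro has_inc_incI[of S _ _ _ T]) (use S T in \<open>auto simp: strict_mono_on_skew_left\<close>)
  next
    assume "has_inc_inc b B p d"
    then obtain S T where S: "S \<subseteq> {1..b}" "card S = p" "strict_mono_on S B"
      and T: "T \<subseteq> {1..b}" "card T = d" "strict_mono_on T B"
      and sep: "\<forall>s\<in>S. \<forall>t\<in>T. s < t \<and> B t < B s"
      by (elim has_inc_incE) (rule that)
    have "\<forall>s\<in>(+) a ` S. \<forall>t\<in>(+) a ` T. s < t \<and> skew a A b B t < skew a A b B s"
    proof (intro ballI, elim imageE, hypsubst)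
      fix s t assume st: "s \<in> S" "t \<in> T"
      then have "s \<in> {1..b}" "t \<in> {1..b}" using S(1) T(1) by auto
      then have "skew a A b B (a + s) = B s" "skew a A b B (a + t) = B t" by (simp_all add: skew_right)
      then show "a + s < a + t \<and> skew a A b B (a + t) < skew a A b B (a + s)"
        using bspec[OF bspec[OF sep st(1)] st(2)] by simp
    qed
    then show ?thesis
      by (intro has_inc_incI[of "(+) a ` S" _ _ _ "(+) a ` T"])
        (use S T in \<open>auto simp: strict_mono_on_skew_right card_image\<close>)
  next
    assume "has_inc a A p" "has_inc b B d"
    then obtain S T where S: "S \<subseteq> {1..a}" "card S = p" "strict_mono_on S A"
      and T: "T \<subseteq> {1..b}" "card T = d" "strict_mono_on T B"
      by (elim has_incE) (rule that)
    have "\<forall>s\<in>S. \<forall>t\<in>(+) a ` T. s < t \<and> skew a A b B t < skew a A b B s"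
    proof (intro ballI)
      fix s t assume "s \<in> S" "t \<in> (+) a ` T"
      then have "1 \<le> s" "s \<le> a" "a < t" "t \<le> a + b" using S(1) T(1) by auto
      then show "s < t \<and> skew a A b B t < skew a A b B s"
        using skew_descent[OF assms(1,2), of s t] by simp
    qed
    then show ?thesis
      by (intro has_inc_incI[of S _ _ _ "(+) a ` T"])
        (use S T in \<open>auto simp: strict_mono_on_skew_right strict_mono_on_skew_left card_image\<close>)
  qed
qed

section \<open>Decomposition of 132-avoiding permutations and involutions\<close>

lemma has_inc_antimono:
  assumes "has_inc n \<alpha> r" "q \<le> r"
  shows "has_inc n \<alpha> q"
proof -
  obtain S where S: "S \<subseteq> {1..n}" "card S = r" "strict_mono_on S \<alpha>"
    using assms(1) by (elim has_incE) (rule that)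
  obtain T where T: "T \<subseteq> S" "card T = q"
    using obtain_subset_with_card_n[of q S] S(2) assms(2) by metis
  show ?thesis
    by (rule has_incI[of T]) (use S T in \<open>auto intro: monotone_on_subset\<close>)
qed

lemma has_inc_0: "has_inc n \<alpha> 0"
  by (rule has_incI[of "{}"]) (simp_all add: monotone_on_def)

lemma has_inc_inc_imp_has_inc:
  assumes "has_inc_inc n \<alpha> p d"
  shows "has_inc n \<alpha> p" "has_inc n \<alpha> d"
proof -
  obtain S T where "S \<subseteq> {1..n}" "card S = p" "strict_mono_on S \<alpha>"
    "T \<subseteq> {1..n}" "card T = d" "strict_mono_on T \<alpha>"
    using assms by (elim has_inc_incE) (rule that)
  then show "has_inc n \<alpha> p" "has_inc n \<alpha> d"
    using has_incI[of S n p \<alpha>] has_incI[of T n d \<alpha>] by simp_all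
qed

section \<open>Behaviour under inversion\<close>

lemma has_inc_inv:
  assumes "\<alpha> permutes {1..n}" "has_inc n \<alpha> r"
  shows "has_inc n (inv \<alpha>) r"
proof -
  obtain S where S: "S \<subseteq> {1..n}" "card S = r" "strict_mono_on S \<alpha>"
    using assms(2) by (elim has_incE) (rule that)
  have inj: "inj_on \<alpha> S" using S(3) by (rule strict_mono_on_imp_inj_on)
  show ?thesis
  proof (rule has_incI[of "\<alpha> ` S"])
    show "\<alpha> ` S \<subseteq> {1..n}" using S(1) permutes_image[OF assms(1)] by blast
    show "card (\<alpha> ` S) = r" using card_image[OF inj] S(2) by simp
    show "strict_mono_on (\<alpha> ` S) (inv \<alpha>)"
    proof (rule strict_mono_onI)
      fix x y assume "x \<in> \<alpha> ` S" "y \<in> \<alpha> ` S" "x < y"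
      then obtain s t where st: "s \<in> S" "t \<in> S" "x = \<alpha> s" "y = \<alpha> t" by blast
      then have "s < t" using strict_mono_on_less[OF S(3) st(1,2)] \<open>x < y\<close> by simp
      then show "inv \<alpha> x < inv \<alpha> y" using st permutes_inverses[OF assms(1)] by simp
    qed
  qed
qed

lemma has_inc_inv_iff:
  assumes "\<alpha> permutes {1..n}"
  shows "has_inc n (inv \<alpha>) r \<longleftrightarrow> has_inc n \<alpha> r"
  using has_inc_inv[OF assms] has_inc_inv[OF permutes_inv[OF assms]]
  unfolding permutes_inv_inv[OF assms] by blast

text \<open>The pattern 132 is its own inverse: the values
  \<open>\<alpha> i < \<alpha> l < \<alpha> j\<close> of an occurrence are the positions of an
  occurrence in the inverse.\<close>

lemma has_132_inv:
  assumes "\<alpha> permutes {1..n}" "has_132 n \<alpha>"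
  shows "has_132 n (inv \<alpha>)"
proof -
  obtain i j l where *: "1 \<le> i" "i < j" "j < l" "l \<le> n" "\<alpha> i < \<alpha> l" "\<alpha> l < \<alpha> j"
    using assms(2) unfolding has_132_def by (elim exE conjE) (rule that)
  have "1 \<le> \<alpha> i" "\<alpha> j \<le> n" using * permutes_in_range[OF assms(1)] by simp_all
  then show ?thesis unfolding has_132_def
    by (intro exI[of _ "\<alpha> i"] exI[of _ "\<alpha> l"] exI[of _ "\<alpha> j"])
      (use * permutes_inverses[OF assms(1)] in simp)
qed

lemma has_132_inv_iff:
  assumes "\<alpha> permutes {1..n}"
  shows "has_132 n (inv \<alpha>) \<longleftrightarrow> has_132 n \<alpha>"
  using has_132_inv[OF assms] has_132_inv[OF permutes_inv[OF assms]]
  unfolding permutes_inv_inv[OF assms] by blast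

text \<open>Appending a maximum at the end does not change the function, as permutations are the
  identity outside their domain. Both sizes can thus speak of the same
  \<open>\<alpha>\<close>.\<close>

lemma permutes_Suc_iff: "\<alpha> permutes {1..n} \<longleftrightarrow> \<alpha> permutes {1..Suc n} \<and> \<alpha> (Suc n) = Suc n"
proof (intro iffI conjI)
  assume \<alpha>: "\<alpha> permutes {1..n}"
  show "\<alpha> permutes {1..Suc n}" by (rule permutes_subset[OF \<alpha>]) auto
  show "\<alpha> (Suc n) = Suc n" using \<alpha> by (rule permutes_outside) simp
next
  assume *: "\<alpha> permutes {1..Suc n} \<and> \<alpha> (Suc n) = Suc n"
  show "\<alpha> permutes {1..n}"
    by (rule permutes_superset[OF conjunct1[OF *]]) (use * in \<open>auto simp: le_Suc_eq\<close>)
qed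

text \<open>The position \<open>Suc n\<close> could only be the last one of an occurrence, but the
  last entry of 132 has a larger entry before it and \<open>Suc n\<close> is the maximum.\<close>

lemma has_132_Suc_fixed:
  assumes \<alpha>: "\<alpha> permutes {1..n}"
  shows "has_132 (Suc n) \<alpha> \<longleftrightarrow> has_132 n \<alpha>"
proof
  assume "has_132 (Suc n) \<alpha>"
  then obtain i j l where *: "1 \<le> i" "i < j" "j < l" "l \<le> Suc n" "\<alpha> i < \<alpha> l" "\<alpha> l < \<alpha> j"
    unfolding has_132_def by (elim exE conjE) (rule that)
  have "\<alpha> j \<le> n" using * by (intro permutes_in_range[OF \<alpha>]) auto
  then have "l \<noteq> Suc n" using * permutes_outside[OF \<alpha>, of "Suc n"] by auto
  then show "has_132 n \<alpha>" unfolding has_132_def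
    by (intro exI[of _ i] exI[of _ j] exI[of _ l]) (use * in simp)
next
  assume "has_132 n \<alpha>"
  then obtain i j l where "1 \<le> i" "i < j" "j < l" "l \<le> n" "\<alpha> i < \<alpha> l" "\<alpha> l < \<alpha> j"
    unfolding has_132_def by (elim exE conjE) (rule that)
  then show "has_132 (Suc n) \<alpha>" unfolding has_132_def
    by (intro exI[of _ i] exI[of _ j] exI[of _ l]) simp
qed

text \<open>A maximum at the end prolongs every increasing subsequence by one; conversely one
  position is removed.\<close>

lemma has_inc_Suc_fixed:
  assumes \<alpha>: "\<alpha> permutes {1..n}"
  shows "has_inc (Suc n) \<alpha> (Suc r) \<longleftrightarrow> has_inc n \<alpha> r"
proof
  assume "has_inc (Suc n) \<alpha> (Suc r)"
  then obtain S where S: "S \<subseteq> {1..Suc n}" "card S = Suc r" "strict_mono_on S \<alpha>"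
    by (elim has_incE) (rule that)
  have fin: "finite S" "S \<noteq> {}" using S(2) card.infinite by fastforce+
  show "has_inc n \<alpha> r"
  \<comment> \<open>Removing the largest position works whether or not \<open>Suc n\<close> belongs
    to \<open>S\<close>.\<close>
  proof (rule has_incI[of "S - {Max S}"])
    have "x \<in> {1..n}" if x: "x \<in> S - {Max S}" for x
    proof -
      have "x \<le> Max S" "Max S \<in> S" using fin x by simp_all
      with S(1) x show ?thesis by fastforce
    qed
    then show "S - {Max S} \<subseteq> {1..n}" by (rule subsetI)
    show "card (S - {Max S}) = r" using S(2) fin by simp
    show "strict_mono_on (S - {Max S}) \<alpha>" using S(3) by (rule monotone_on_subset) blast
  qed
next
  assume "has_inc n \<alpha> r"
  then obtain S where S: "S \<subseteq> {1..n}" "card S = r" "strict_mono_on S \<alpha>"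
    by (elim has_incE) (rule that)
  have le: "\<alpha> x < Suc n \<and> x < Suc n" if "x \<in> S" for x
    using permutes_in_range(2)[OF \<alpha>, of x] S(1) that by fastforce
  show "has_inc (Suc n) \<alpha> (Suc r)"
  proof (rule has_incI[of "insert (Suc n) S"])
    show "insert (Suc n) S \<subseteq> {1..Suc n}" using S(1) by auto
    have "finite S" using S(1) finite_subset by blast
    moreover have "Suc n \<notin> S" using le by blast
    ultimately show "card (insert (Suc n) S) = Suc r" using S(2) by simp
    show "strict_mono_on (insert (Suc n) S) \<alpha>"
    proof (rule strict_mono_onI)
      fix x y assume "x \<in> insert (Suc n) S" "y \<in> insert (Suc n) S" "x < y"
      then show "\<alpha> x < \<alpha> y"
        using le[of x] le[of y] strict_mono_onD[OF S(3), of x y] permutes_outside[OF \<alpha>, of "Suc n"]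
        by auto
    qed
  qed
qed

text \<open>The appended entry cannot belong to \<open>S\<close>, since a position of
  \<open>T\<close> would have to follow, nor to \<open>T\<close>, since a larger value would have to
  precede it.\<close>

lemma has_inc_inc_Suc_fixed:
  assumes \<alpha>: "\<alpha> permutes {1..n}" and pd: "p \<ge> 1" "d \<ge> 1"
  shows "has_inc_inc (Suc n) \<alpha> p d \<longleftrightarrow> has_inc_inc n \<alpha> p d"
proof
  assume "has_inc_inc (Suc n) \<alpha> p d"
  then obtain S T where S: "S \<subseteq> {1..Suc n}" "card S = p" "strict_mono_on S \<alpha>"
    and T: "T \<subseteq> {1..Suc n}" "card T = d" "strict_mono_on T \<alpha>"
    and sep: "\<forall>s\<in>S. \<forall>t\<in>T. s < t \<and> \<alpha> t < \<alpha> s"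
    by (elim has_inc_incE) (rule that)
  have "S \<noteq> {}" "T \<noteq> {}" using S(2) T(2) pd by auto
  then obtain s t where st: "s \<in> S" "t \<in> T" by blast
  have "Suc n \<notin> S"
  proof
    assume "Suc n \<in> S"
    then have "Suc n < t" using sep st by blast
    then show False using T(1) st by auto
  qed
  moreover have "Suc n \<notin> T"
  proof
    assume "Suc n \<in> T"
    then have "s < Suc n" "Suc n < \<alpha> s"
      using bspec[OF bspec[OF sep st(1)], of "Suc n"] permutes_outside[OF \<alpha>, of "Suc n"] by auto
    moreover have "1 \<le> s" using S(1) st by auto
    ultimately show False using permutes_in_range(2)[OF \<alpha>, of s] by simp
  qed
  moreover have "{1..Suc n} - {Suc n} = {1..n}" by auto
  ultimately have "S \<subseteq> {1..n}" "T \<subseteq> {1..n}" using S(1) T(1) by blast+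
  with S T sep show "has_inc_inc n \<alpha> p d" by (intro has_inc_incI[of S _ _ _ T])
next
  assume "has_inc_inc n \<alpha> p d"
  then obtain S T where S: "S \<subseteq> {1..n}" "card S = p" "strict_mono_on S \<alpha>"
    and T: "T \<subseteq> {1..n}" "card T = d" "strict_mono_on T \<alpha>"
    and sep: "\<forall>s\<in>S. \<forall>t\<in>T. s < t \<and> \<alpha> t < \<alpha> s"
    by (elim has_inc_incE) (rule that)
  have "{1..n} \<subseteq> {1..Suc n}" by simp
  with S T sep show "has_inc_inc (Suc n) \<alpha> p d" by (intro has_inc_incI[of S _ _ _ T]) (blast | assumption)+
qed

section \<open>The classes of 132-avoiding permutations and involutions\<close>

definition av132 :: "nat \<Rightarrow> (nat \<Rightarrow> nat) set" where
  "av132 n = {\<alpha>. \<alpha> permutes {1..n} \<and> \<not> has_132 n \<alpha>}"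

definition inv132 :: "nat \<Rightarrow> (nat \<Rightarrow> nat) set" where
  "inv132 n = {\<alpha> \<in> av132 n. inv \<alpha> = \<alpha>}"

lemma av132_permutes: "\<alpha> \<in> av132 n \<Longrightarrow> \<alpha> permutes {1..n}"
  by (simp add: av132_def)

lemma inv132_permutes: "\<alpha> \<in> inv132 n \<Longrightarrow> \<alpha> permutes {1..n}"
  by (simp add: inv132_def av132_def)

lemma finite_av132: "finite (av132 n)"
  by (rule finite_subset[OF _ finite_permutations[of "{1..n}"]]) (auto simp: av132_def)

lemma finite_inv132: "finite (inv132 n)"
  by (rule finite_subset[OF _ finite_av132]) (auto simp: inv132_def)

lemma av132_0: "av132 0 = {id}"
  by (auto simp: av132_def has_132_def permutes_empty)

lemma inv132_0: "inv132 0 = {id}"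
  by (auto simp: inv132_def av132_0)

lemma av132_Suc_fixed: "{\<alpha> \<in> av132 (Suc n). \<alpha> (Suc n) = Suc n} = av132 n"
  unfolding av132_def using has_132_Suc_fixed permutes_Suc_iff[of _ n] by blast

lemma inv132_Suc_fixed: "{\<alpha> \<in> inv132 (Suc n). \<alpha> (Suc n) = Suc n} = inv132 n"
  unfolding inv132_def using av132_Suc_fixed[of n] by blast

lemma inv_av132: "\<alpha> \<in> av132 n \<Longrightarrow> inv \<alpha> \<in> av132 n"
  by (simp add: av132_def permutes_inv has_132_inv_iff)

lemma skew_in_av132_iff:
  assumes "A permutes {1..a}" "B permutes {1..b}"
  shows "skew a A b B \<in> av132 (a + b) \<longleftrightarrow> A \<in> av132 a \<and> B \<in> av132 b"
  using skew_permutes[OF assms] has_132_skew[OF assms] assms unfolding av132_def by blast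

lemma av132_Suc: "L \<in> av132 a \<Longrightarrow> L \<in> av132 (Suc a) \<and> L (Suc a) = Suc a"
  using av132_Suc_fixed[of a] by blast

text \<open>An entry before the maximum and a larger entry after it would form 132 together with the
  maximum. Hence every entry up to the maximum lies above every later one, and the permutation
  splits right after the maximum.\<close>

lemma av132_decompose:
  assumes "\<alpha> \<in> av132 (Suc a + b)" "\<alpha> (Suc a) = Suc a + b"
  obtains L R where "L \<in> av132 a" "R \<in> av132 b" "\<alpha> = skew (Suc a) L b R"
proof -
  have \<alpha>: "\<alpha> permutes {1..Suc a + b}" and no: "\<not> has_132 (Suc a + b) \<alpha>"
    using assms(1) by (simp_all add: av132_def)
  have "\<alpha> l < \<alpha> i" if il: "1 \<le> i" "i \<le> Suc a" "Suc a < l" "l \<le> Suc a + b" for i l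
  proof (rule ccontr)
    assume "\<not> \<alpha> l < \<alpha> i"
    moreover have "\<alpha> l \<noteq> \<alpha> i" "\<alpha> l \<noteq> \<alpha> (Suc a)"
      using injD[OF permutes_inj[OF \<alpha>]] il by fastforce+
    moreover have "\<alpha> l \<le> Suc a + b" using il by (intro permutes_in_range[OF \<alpha>]) auto
    ultimately have "\<alpha> i < \<alpha> l" "\<alpha> l < \<alpha> (Suc a)" using assms(2) by auto
    moreover from this have "i < Suc a" using il by (cases "i = Suc a") auto
    ultimately have "has_132 (Suc a + b) \<alpha>" unfolding has_132_def
      by (intro exI[of _ i] exI[of _ "Suc a"] exI[of _ l]) (use il in simp)
    with no show False by blast
  qed
  with \<alpha> have "\<alpha> ` {1..Suc a} = {b+1..Suc a+b}" by (rule image_prefix_if_descent)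
  from skew_decompose[OF \<alpha> this] obtain L R
    where LR: "L permutes {1..Suc a}" "R permutes {1..b}" "\<alpha> = skew (Suc a) L b R" .
  \<comment> \<open>At this point \<open>L\<close> still includes the maximum, as its fixed last
    entry; this puts it into \<open>av132 a\<close> as well.\<close>
  have "L (Suc a) = Suc a" using assms(2) LR(3) by (simp add: skew_left)
  moreover have "L \<in> av132 (Suc a)" "R \<in> av132 b"
    using skew_in_av132_iff[OF LR(1,2)] LR(3) assms(1) by blast+
  ultimately show thesis using that[of L R] LR(3) av132_Suc_fixed[of a] by blast
qed

lemma bij_betw_av132:
  "bij_betw (\<lambda>(L, R). skew (Suc a) L b R) (av132 a \<times> av132 b)
     {\<alpha> \<in> av132 (Suc a + b). \<alpha> (Suc a) = Suc a + b}"
proof (rule bij_betwI')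
  fix x y assume "x \<in> av132 a \<times> av132 b" "y \<in> av132 a \<times> av132 b"
  then obtain L R L' R' where *: "x = (L, R)" "y = (L', R')"
    "L permutes {1..Suc a}" "R permutes {1..b}" "L' permutes {1..Suc a}" "R' permutes {1..b}"
    using av132_permutes av132_Suc by blast
  then show "((case x of (L, R) \<Rightarrow> skew (Suc a) L b R) = (case y of (L, R) \<Rightarrow> skew (Suc a) L b R)) = (x = y)"
    using skew_eqD[of "Suc a" L b R L' R'] by auto
next
  fix x assume "x \<in> av132 a \<times> av132 b"
  then obtain L R where *: "x = (L, R)" "L \<in> av132 (Suc a)" "L (Suc a) = Suc a" "R \<in> av132 b"
    using av132_Suc by blast
  then show "(case x of (L, R) \<Rightarrow> skew (Suc a) L b R) \<in> {\<alpha> \<in> av132 (Suc a + b). \<alpha> (Suc a) = Suc a + b}"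
    using skew_in_av132_iff[OF av132_permutes[OF *(2)] av132_permutes[OF *(4)]]
    by (simp add: skew_left)
next
  fix \<alpha> assume "\<alpha> \<in> {\<alpha> \<in> av132 (Suc a + b). \<alpha> (Suc a) = Suc a + b}"
  then obtain L R where "L \<in> av132 a" "R \<in> av132 b" "\<alpha> = skew (Suc a) L b R"
    using av132_decompose[of \<alpha> a b] by blast
  then show "\<exists>x\<in>av132 a \<times> av132 b. \<alpha> = (case x of (L, R) \<Rightarrow> skew (Suc a) L b R)"
    by (intro bexI[of _ "(L, R)"]) simp_all
qed

section \<open>Involutions as skew sums of three blocks\<close>

text \<open>
  As \<open>L\<close> permutes \<open>{1..a}\<close> and fixes \<open>a + 1\<close>, the block \<open>skew (Suc a) L\<close> is \<open>L\<close> followed by the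
  maximum, and the last block \<open>inv L\<close> again ends in its fixed point.
\<close>

definition skew3 :: "nat \<Rightarrow> (nat \<Rightarrow> nat) \<Rightarrow> nat \<Rightarrow> (nat \<Rightarrow> nat) \<Rightarrow> nat \<Rightarrow> nat" where
  "skew3 a L m M = skew (Suc a) L (m + Suc a) (skew m M (Suc a) (inv L))"

text \<open>Inversion exchanges and inverts the outer blocks \<open>L\<close> and
  \<open>inv L\<close> and fixes the middle block \<open>M\<close>. Avoidance of 132 passes
  blockwise and is stable under inversion.\<close>

lemma skew3_in_inv132:
  assumes L: "L \<in> av132 a" and M: "M \<in> inv132 m"
  shows "skew3 a L m M \<in> inv132 (Suc a + (m + Suc a))" "skew3 a L m M (Suc a) = Suc a + (m + Suc a)"
proof -
  have L': "L \<in> av132 (Suc a)" "L (Suc a) = Suc a" using av132_Suc[OF L] by simp_all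
  have M': "M \<in> av132 m" "inv M = M" using M by (simp_all add: inv132_def)
  have p: "L permutes {1..Suc a}" "M permutes {1..m}" "inv L permutes {1..Suc a}"
    using av132_permutes[OF L'(1)] av132_permutes[OF M'(1)] permutes_inv by blast+
  have pp: "skew m M (Suc a) (inv L) permutes {1..m + Suc a}" using skew_permutes[OF p(2,3)] .
  have "skew3 a L m M \<in> av132 (Suc a + (m + Suc a))"
    unfolding skew3_def using skew_in_av132_iff[OF p(1) pp] skew_in_av132_iff[OF p(2,3)] L' M' inv_av132
    by blast
  moreover have "inv (skew3 a L m M) = skew3 a L m M"
    unfolding skew3_def inv_skew[OF p(1) pp] inv_skew[OF p(2,3)] permutes_inv_inv[OF p(1)] M'(2)
    using skew_assoc[of "Suc a" m L M "Suc a" "inv L"] by (simp only: add.commute)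
  ultimately show "skew3 a L m M \<in> inv132 (Suc a + (m + Suc a))" by (simp add: inv132_def)
  show "skew3 a L m M (Suc a) = Suc a + (m + Suc a)" using L' by (simp add: skew3_def skew_left)
qed

lemma inv132_invol: "\<alpha> \<in> inv132 n \<Longrightarrow> \<alpha> (\<alpha> i) = i"
  using permutes_inverses(2)[of \<alpha> "{1..n}" i] by (simp add: inv132_def av132_def)

text \<open>The split after the maximum leaves a block \<open>R\<close>. Self-inverseness forces the
  last \<open>Suc a\<close> positions to take the lowest \<open>Suc a\<close> values, so
  \<open>R\<close> splits again; comparing \<open>\<alpha>\<close> with its inverse block by block
  then gives \<open>inv M = M\<close> and \<open>K = inv L\<close>.\<close>

lemma inv132_decompose:
  assumes \<alpha>: "\<alpha> \<in> inv132 (Suc n)" and a: "\<alpha> (Suc a) = Suc n" "a < n"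
  obtains L m M where "Suc n = Suc a + (m + Suc a)" "L \<in> av132 a" "M \<in> inv132 m" "\<alpha> = skew3 a L m M"
proof -
  define b where "b = n - a"
  have n: "Suc n = Suc a + b" using a(2) by (simp add: b_def)
  have av: "\<alpha> \<in> av132 (Suc a + b)" using \<alpha> unfolding n by (simp add: inv132_def)
  obtain L R where LR: "L \<in> av132 a" "R \<in> av132 b" "\<alpha> = skew (Suc a) L b R"
    using av132_decompose[OF av] a(1) n by metis
  have L': "L \<in> av132 (Suc a)" "L permutes {1..Suc a}" "R permutes {1..b}"
    using LR av132_Suc av132_permutes by blast+
  \<comment> \<open>The last entry mirrors the maximum. As it is a value of \<open>R\<close>, there
    is room for a final block of size \<open>Suc a\<close>.\<close>
  have "\<alpha> (Suc n) = Suc a" using inv132_invol[OF \<alpha>, of "Suc a"] a(1) by simp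
  moreover have "\<alpha> (Suc n) = R b" using LR(3) n a(2) by (simp add: skew_right b_def)
  moreover have "R b \<le> b" using a(2) by (intro permutes_in_range[OF L'(3)]) (auto simp: b_def)
  ultimately have "Suc a \<le> b" by simp
  define m where "m = b - Suc a"
  have b: "b = m + Suc a" using \<open>Suc a \<le> b\<close> by (simp add: m_def)
  have hi: "\<alpha> x \<in> {b+1..Suc a + b}" if "1 \<le> x" "x \<le> Suc a" for x
    using permutes_in_range[OF L'(2) that] that LR(3) by (simp add: skew_left)
  \<comment> \<open>If \<open>R y\<close> were at most \<open>Suc a\<close>, then
    \<open>\<alpha>\<close> would send it above \<open>b\<close>; yet \<open>\<alpha>\<close> sends
    it back to the position \<open>Suc a + y\<close>, which is at most \<open>b\<close>.\<close>
  have low: "R y \<notin> {1..Suc a}" if "y \<in> {1..m}" for y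
  proof
    assume "R y \<in> {1..Suc a}"
    moreover have "\<alpha> (Suc a + y) = R y" using that LR(3) b by (simp add: skew_right)
    ultimately have "\<alpha> (R y) \<in> {b+1..Suc a + b}" "\<alpha> (R y) = Suc a + y"
      using hi[of "R y"] inv132_invol[OF \<alpha>, of "Suc a + y"] by auto
    then show False using that b by simp
  qed
  have Rp: "R permutes {1..m + Suc a}" using L'(3) b by simp
  have "R ` {1..m} \<subseteq> {Suc a + 1..m + Suc a}"
  proof (rule image_subsetI)
    fix y assume y: "y \<in> {1..m}"
    then have "1 \<le> R y" "R y \<le> m + Suc a" using permutes_in_range[OF Rp, of y] by simp_all
    with low[OF y] show "R y \<in> {Suc a + 1..m + Suc a}" by simp
  qed
  moreover have "card (R ` {1..m}) = card {Suc a + 1..m + Suc a}"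
    using card_image[OF inj_on_subset[OF permutes_inj[OF Rp] subset_UNIV], of "{1..m}"] by simp
  ultimately have "R ` {1..m} = {Suc a + 1..m + Suc a}" by (intro card_subset_eq) simp_all
  from skew_decompose[OF Rp this] obtain M K
    where MK: "M permutes {1..m}" "K permutes {1..Suc a}" "R = skew m M (Suc a) K" .
  have eq: "\<alpha> = skew (Suc a) L (m + Suc a) (skew m M (Suc a) K)" using LR(3) MK(3) b by simp
  have pp: "skew m M (Suc a) K permutes {1..m + Suc a}" using skew_permutes[OF MK(1,2)] .
  \<comment> \<open>The inverse has the same block sizes after rebracketing, so uniqueness of blocks
    applies twice.\<close>
  have "inv \<alpha> = skew (m + Suc a) (skew (Suc a) (inv K) m (inv M)) (Suc a) (inv L)"
    unfolding eq inv_skew[OF L'(2) pp] inv_skew[OF MK(1,2)] ..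
  also have "\<dots> = skew (Suc a) (inv K) (m + Suc a) (skew m (inv M) (Suc a) (inv L))"
    using skew_assoc[of "Suc a" m "inv K" "inv M" "Suc a" "inv L"] by (simp only: add.commute)
  finally have "skew (Suc a) (inv K) (m + Suc a) (skew m (inv M) (Suc a) (inv L)) =
      skew (Suc a) L (m + Suc a) (skew m M (Suc a) K)"
    using \<alpha> eq by (simp add: inv132_def)
  from skew_eqD[OF this permutes_inv[OF MK(2)] skew_permutes[OF permutes_inv[OF MK(1)] permutes_inv[OF L'(2)]] L'(2) pp]
  have "skew m (inv M) (Suc a) (inv L) = skew m M (Suc a) K" by blast
  from skew_eqD[OF this permutes_inv[OF MK(1)] permutes_inv[OF L'(2)] MK(1,2)]
  have M: "inv M = M" "inv L = K" by simp_all
  moreover have "M \<in> av132 m" using skew_in_av132_iff[OF MK(1,2)] LR(2) MK(3) b by simp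
  ultimately have "M \<in> inv132 m" by (simp add: inv132_def)
  moreover have "\<alpha> = skew3 a L m M" using eq M by (simp add: skew3_def)
  moreover have "Suc n = Suc a + (m + Suc a)" using n b by simp
  ultimately show thesis using that[of m L M] LR(1) by blast
qed

lemma bij_betw_inv132:
  "bij_betw (\<lambda>(L, M). skew3 a L m M) (av132 a \<times> inv132 m)
     {\<alpha> \<in> inv132 (Suc a + (m + Suc a)). \<alpha> (Suc a) = Suc a + (m + Suc a)}"
proof (rule bij_betwI')
  fix x y assume "x \<in> av132 a \<times> inv132 m" "y \<in> av132 a \<times> inv132 m"
  then obtain L M L' M' where *: "x = (L, M)" "y = (L', M')"
    "L permutes {1..Suc a}" "M permutes {1..m}" "L' permutes {1..Suc a}" "M' permutes {1..m}"
    using av132_permutes inv132_permutes av132_Suc by blast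
  have "L = L' \<and> M = M'" if "skew3 a L m M = skew3 a L' m M'"
    using skew_eqD[OF that[unfolded skew3_def] *(3) skew_permutes[OF *(4) permutes_inv[OF *(3)]]
        *(5) skew_permutes[OF *(6) permutes_inv[OF *(5)]]]
      skew_eqD[OF _ *(4) permutes_inv[OF *(3)] *(6) permutes_inv[OF *(5)]] by blast
  then show "((case x of (L, M) \<Rightarrow> skew3 a L m M) = (case y of (L, M) \<Rightarrow> skew3 a L m M)) = (x = y)"
    using *(1,2) by auto
next
  fix x assume "x \<in> av132 a \<times> inv132 m"
  then show "(case x of (L, M) \<Rightarrow> skew3 a L m M) \<in>
      {\<alpha> \<in> inv132 (Suc a + (m + Suc a)). \<alpha> (Suc a) = Suc a + (m + Suc a)}"
    using skew3_in_inv132 by (auto simp del: add_Suc add_Suc_right)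
next
  fix \<alpha> assume "\<alpha> \<in> {\<alpha> \<in> inv132 (Suc a + (m + Suc a)). \<alpha> (Suc a) = Suc a + (m + Suc a)}"
  then have "\<alpha> \<in> inv132 (Suc (a + (m + Suc a)))" "\<alpha> (Suc a) = Suc (a + (m + Suc a))" by simp_all
  \<comment> \<open>The size equation forces \<open>m' = m\<close>.\<close>
  then obtain L m' M where "Suc (a + (m + Suc a)) = Suc a + (m' + Suc a)"
    "L \<in> av132 a" "M \<in> inv132 m'" "\<alpha> = skew3 a L m' M"
    by (rule inv132_decompose) simp_all
  then show "\<exists>x\<in>av132 a \<times> inv132 m. \<alpha> = (case x of (L, M) \<Rightarrow> skew3 a L m M)"
    by (intro bexI[of _ "(L, M)"]) simp_all
qed

section \<open>Generating functions\<close>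

text \<open>The predicate receives the size as well, because the function does not determine it:
  trailing fixed points are invisible.\<close>

definition av_gf :: "(nat \<Rightarrow> (nat \<Rightarrow> nat) \<Rightarrow> bool) \<Rightarrow> real fps" where
  "av_gf P = Abs_fps (\<lambda>n. real (card {\<alpha> \<in> av132 n. P n \<alpha>}))"

definition inv_gf :: "(nat \<Rightarrow> (nat \<Rightarrow> nat) \<Rightarrow> bool) \<Rightarrow> real fps" where
  "inv_gf P = Abs_fps (\<lambda>n. real (card {\<alpha> \<in> inv132 n. P n \<alpha>}))"

section \<open>Counting by the position of the maximum\<close>

lemma card_filter_bij_betw:
  assumes "bij_betw f A B"
  shows "card {y \<in> B. P y} = card {x \<in> A. P (f x)}"
proof -
  have "bij_betw f {x \<in> A. P (f x)} {y \<in> B. P y}"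
    using assms by (auto simp: bij_betw_def inj_on_def)
  then show ?thesis by (metis bij_betw_same_card)
qed

lemma card_partition_fibres:
  assumes "finite A" "finite I" "\<And>x. x \<in> A \<Longrightarrow> f x \<in> I"
  shows "card A = (\<Sum>i\<in>I. card {x \<in> A. f x = i})"
proof -
  have "A = (\<Union>i\<in>I. {x \<in> A. f x = i})" using assms(3) by blast
  also have "card \<dots> = (\<Sum>i\<in>I. card {x \<in> A. f x = i})"
    by (rule card_UN_disjoint) (use assms(1,2) in auto)
  finally show ?thesis .
qed

text \<open>The summand \<open>a\<close> collects the permutations whose maximum stands at position
  \<open>Suc a\<close>, with \<open>n - a\<close> entries after it.\<close>

lemma card_av132_Suc:
  "card {\<alpha> \<in> av132 (Suc n). P \<alpha>} =
     (\<Sum>a=0..n. card {x \<in> av132 a \<times> av132 (n - a). P (skew (Suc a) (fst x) (n - a) (snd x))})"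
proof -
  have "inv \<alpha> (Suc n) - 1 \<in> {0..n}" if "\<alpha> \<in> av132 (Suc n)" for \<alpha>
    using permutes_in_range(2)[OF permutes_inv[OF av132_permutes[OF that]], of "Suc n"] by simp
  then have "card {\<alpha> \<in> av132 (Suc n). P \<alpha>} =
      (\<Sum>a=0..n. card {\<alpha> \<in> {\<alpha> \<in> av132 (Suc n). P \<alpha>}. inv \<alpha> (Suc n) - 1 = a})"
    using finite_av132 by (intro card_partition_fibres) auto
  also have "\<dots> = (\<Sum>a=0..n. card {x \<in> av132 a \<times> av132 (n - a). P (skew (Suc a) (fst x) (n - a) (snd x))})"
  proof (rule sum.cong)
    fix a assume "a \<in> {0..n}"
    then have a: "Suc a + (n - a) = Suc n" by simp
    \<comment> \<open>The position of the maximum is at least 1, so the truncated subtraction loses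
      nothing.\<close>
    have "inv \<alpha> (Suc n) - 1 = a \<longleftrightarrow> \<alpha> (Suc a) = Suc n" if "\<alpha> \<in> av132 (Suc n)" for \<alpha>
    proof -
      have \<alpha>: "\<alpha> permutes {1..Suc n}" using that by (rule av132_permutes)
      have "1 \<le> inv \<alpha> (Suc n)" using permutes_in_range(1)[OF permutes_inv[OF \<alpha>], of "Suc n"] by simp
      then have "inv \<alpha> (Suc n) - 1 = a \<longleftrightarrow> inv \<alpha> (Suc n) = Suc a" by linarith
      also have "\<dots> \<longleftrightarrow> \<alpha> (Suc a) = Suc n" using permutes_inverses[OF \<alpha>] by metis
      finally show ?thesis .
    qed
    then have "{\<alpha> \<in> {\<alpha> \<in> av132 (Suc n). P \<alpha>}. inv \<alpha> (Suc n) - 1 = a} =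
        {\<alpha> \<in> {\<alpha> \<in> av132 (Suc n). \<alpha> (Suc a) = Suc n}. P \<alpha>}" by blast
    then show "card {\<alpha> \<in> {\<alpha> \<in> av132 (Suc n). P \<alpha>}. inv \<alpha> (Suc n) - 1 = a} =
        card {x \<in> av132 a \<times> av132 (n - a). P (skew (Suc a) (fst x) (n - a) (snd x))}"
      using card_filter_bij_betw[OF bij_betw_av132[of a "n - a", unfolded a], of P]
      by (simp only: case_prod_beta)
  qed simp
  finally show ?thesis .
qed

text \<open>Involutions that fix \<open>Suc n\<close> are those of size \<open>n\<close>. The others
  split by the position \<open>Suc a\<close> of the maximum; two outer blocks of size
  \<open>Suc a\<close> leave \<open>n - 1 - 2 * a\<close> for the middle.\<close>

lemma card_inv132_Suc:
  "card {\<alpha> \<in> inv132 (Suc n). P \<alpha>} = card {\<alpha> \<in> inv132 n. P \<alpha>} +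
     (\<Sum>a | 2 * a + 2 \<le> Suc n. card {x \<in> av132 a \<times> inv132 (n - 1 - 2 * a).
        P (skew3 a (fst x) (n - 1 - 2 * a) (snd x))})"
proof -
  let ?A = "{\<alpha> \<in> inv132 (Suc n). P \<alpha>}" and ?I = "{a. 2 * a + 2 \<le> Suc n}"
  have finI: "finite ?I" by (rule finite_subset[of _ "{..n}"]) auto
  let ?B = "{\<alpha> \<in> ?A. \<alpha> (Suc n) \<noteq> Suc n}"
  have split: "?A = {\<alpha> \<in> inv132 n. P \<alpha>} \<union> ?B" using inv132_Suc_fixed[of n] by blast
  have "card ?A = card {\<alpha> \<in> inv132 n. P \<alpha>} + card ?B"
    by (subst split, rule card_Un_disjoint) (use finite_inv132 inv132_Suc_fixed[of n] in auto)
  also have "card ?B = (\<Sum>a\<in>?I. card {\<alpha> \<in> ?B. \<alpha> (Suc n) - 1 = a})"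
  proof (rule card_partition_fibres)
    fix \<alpha> assume "\<alpha> \<in> ?B"
    then have \<alpha>: "\<alpha> \<in> inv132 (Suc n)" "\<alpha> (Suc n) \<noteq> Suc n" by simp_all
    have r: "1 \<le> \<alpha> (Suc n)" "\<alpha> (Suc n) \<le> Suc n"
      using permutes_in_range[OF inv132_permutes[OF \<alpha>(1)], of "Suc n"] by simp_all
    define a where "a = \<alpha> (Suc n) - 1"
    have "\<alpha> (Suc a) = Suc n" using inv132_invol[OF \<alpha>(1), of "Suc n"] r by (simp add: a_def)
    moreover have "a < n" using r \<alpha>(2) by (simp add: a_def)
    ultimately obtain m where "Suc n = Suc a + (m + Suc a)"
      using inv132_decompose[OF \<alpha>(1), of a] by metis
    then show "\<alpha> (Suc n) - 1 \<in> ?I" by (simp add: a_def)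
  qed (use finI finite_inv132 in simp_all)
  also have "\<dots> = (\<Sum>a | 2 * a + 2 \<le> Suc n. card {x \<in> av132 a \<times> inv132 (n - 1 - 2 * a).
        P (skew3 a (fst x) (n - 1 - 2 * a) (snd x))})"
  proof (rule sum.cong)
    fix a assume "a \<in> ?I"
    then have a: "Suc a + ((n - 1 - 2 * a) + Suc a) = Suc n" by simp
    \<comment> \<open>For an involution the last entry is also the position of the maximum. It
      differs from \<open>Suc n\<close> because two outer blocks fit into
      \<open>Suc n\<close>.\<close>
    have eq: "\<alpha> (Suc n) \<noteq> Suc n \<and> \<alpha> (Suc n) - 1 = a \<longleftrightarrow> \<alpha> (Suc a) = Suc n"
      if "\<alpha> \<in> inv132 (Suc n)" for \<alpha>
    proof -
      have \<alpha>: "\<alpha> permutes {1..Suc n}" using that by (rule inv132_permutes)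
      have "1 \<le> \<alpha> (Suc n)" using permutes_in_range(1)[OF \<alpha>, of "Suc n"] by simp
      then have "\<alpha> (Suc n) \<noteq> Suc n \<and> \<alpha> (Suc n) - 1 = a \<longleftrightarrow> \<alpha> (Suc n) = Suc a"
        using a by linarith
      also have "\<dots> \<longleftrightarrow> \<alpha> (Suc a) = Suc n" using inv132_invol[OF that] by metis
      finally show ?thesis .
    qed
    have "{\<alpha> \<in> ?B. \<alpha> (Suc n) - 1 = a} = {\<alpha> \<in> {\<alpha> \<in> inv132 (Suc n). \<alpha> (Suc a) = Suc n}. P \<alpha>}"
      using eq by blast
    then show "card {\<alpha> \<in> ?B. \<alpha> (Suc n) - 1 = a} =
        card {x \<in> av132 a \<times> inv132 (n - 1 - 2 * a). P (skew3 a (fst x) (n - 1 - 2 * a) (snd x))}"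
      using card_filter_bij_betw[OF bij_betw_inv132[of a "n - 1 - 2 * a", unfolded a], of P]
      by (simp only: case_prod_beta)
  qed simp
  finally show ?thesis .
qed

text \<open>Only even coefficients survive the substitution of \<open>fps_X^2\<close>. It arises
  because \<open>L\<close> and its mirror image together occupy \<open>2 * a\<close> entries apart
  from their last ones.\<close>

lemma fps_compose_X2_mult_nth:
  "((f oo fps_X^2) * g) $ n = (\<Sum>a | 2 * a \<le> n. f $ a * g $ (n - 2 * a))" for f g :: "real fps"
proof -
  have "((f oo fps_X^2) * g) $ n = (\<Sum>i=0..n. (if 2 dvd i then f $ (i div 2) else 0) * g $ (n - i))"
    by (simp add: fps_mult_nth fps_nth_compose_X_power)
  also have "\<dots> = (\<Sum>i\<in>(*) 2 ` {a. 2 * a \<le> n}. (if 2 dvd i then f $ (i div 2) else 0) * g $ (n - i))"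
    by (rule sum.mono_neutral_right) (auto elim!: evenE)
  also have "\<dots> = (\<Sum>a | 2 * a \<le> n. f $ a * g $ (n - 2 * a))"
    by (subst sum.reindex) (auto simp: inj_on_def)
  finally show ?thesis .
qed

text \<open>A common frame for both recurrences on involutions. \<open>Q\<close> is what
  \<open>P\<close> becomes once a fixed last maximum is dropped, and \<open>c a m\<close> counts the
  admissible pairs of blocks. The factor \<open>fps_X^2\<close> accounts for the maximum and its
  mirror entry.\<close>

lemma inv_gf_rec:
  fixes c :: "nat \<Rightarrow> nat \<Rightarrow> real"
  assumes P0: "P 0 id"
    and fixed: "\<And>n \<alpha>. \<alpha> permutes {1..n} \<Longrightarrow> P (Suc n) \<alpha> \<longleftrightarrow> Q n \<alpha>"
    and c: "\<And>a m. real (card {x \<in> av132 a \<times> inv132 m. P (Suc a + (m + Suc a)) (skew3 a (fst x) m (snd x))}) = c a m"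
  shows "inv_gf P = 1 + fps_X * inv_gf Q + fps_X^2 * Abs_fps (\<lambda>n. \<Sum>a | 2 * a \<le> n. c a (n - 2 * a))"
proof (rule fps_ext)
  fix n
  let ?R = "\<lambda>n. \<Sum>a | 2 * a \<le> n. c a (n - 2 * a)"
  show "inv_gf P $ n = (1 + fps_X * inv_gf Q + fps_X^2 * Abs_fps ?R) $ n"
  proof (cases n)
    case 0
    have "{\<alpha> \<in> inv132 0. P 0 \<alpha>} = {id}" using P0 by (auto simp: inv132_0)
    then show ?thesis using 0 by (simp add: inv_gf_def)
  next
    case (Suc k)
    have "{\<alpha> \<in> inv132 k. P (Suc k) \<alpha>} = {\<alpha> \<in> inv132 k. Q k \<alpha>}"
      using fixed inv132_permutes by blast
    then have 1: "inv_gf P $ n = inv_gf Q $ k +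
        (\<Sum>a | 2 * a + 2 \<le> n. real (card {x \<in> av132 a \<times> inv132 (k - 1 - 2 * a).
          P (Suc k) (skew3 a (fst x) (k - 1 - 2 * a) (snd x))}))"
      using card_inv132_Suc[of k "P (Suc k)"] Suc by (simp add: inv_gf_def)
    also have "(\<Sum>a | 2 * a + 2 \<le> n. real (card {x \<in> av132 a \<times> inv132 (k - 1 - 2 * a).
          P (Suc k) (skew3 a (fst x) (k - 1 - 2 * a) (snd x))})) = (\<Sum>a | 2 * a + 2 \<le> n. c a (n - 2 - 2 * a))"
    proof (rule sum.cong)
      fix a assume "a \<in> {a. 2 * a + 2 \<le> n}"
      \<comment> \<open>With \<open>2 * a + 2 \<le> n\<close> the truncated subtraction is exact, so
        the middle block has its true size.\<close>
      then have "Suc a + ((k - 1 - 2 * a) + Suc a) = Suc k" using Suc by simp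
      then show "real (card {x \<in> av132 a \<times> inv132 (k - 1 - 2 * a).
          P (Suc k) (skew3 a (fst x) (k - 1 - 2 * a) (snd x))}) = c a (n - 2 - 2 * a)"
        using c[of a "k - 1 - 2 * a"] Suc by simp
    qed simp
    also have "\<dots> = (fps_X^2 * Abs_fps ?R) $ n"
    proof (cases "2 \<le> n")
      case True
      then have "{a. 2 * a + 2 \<le> n} = {a. 2 * a \<le> n - 2}" by auto
      then show ?thesis using True by (simp add: fps_X_power_mult_nth)
    next
      case False
      then have "{a. 2 * a + 2 \<le> n} = {}" by auto
      then show ?thesis using False by (simp add: fps_X_power_mult_nth)
    qed
    finally show ?thesis using Suc by simp
  qed
qed

lemma Abs_fps_compose_X2_mult:
  "Abs_fps (\<lambda>n. \<Sum>a | 2 * a \<le> n. f $ a * g $ (n - 2 * a)) = (f oo fps_X^2) * g" for f g :: "real fps"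
  by (rule fps_ext) (simp add: fps_compose_X2_mult_nth)

section \<open>Recurrences for the generating functions\<close>

abbreviation av_inc_gf :: "nat \<Rightarrow> real fps" where
  "av_inc_gf r \<equiv> av_gf (\<lambda>n \<alpha>. \<not> has_inc n \<alpha> r)"

abbreviation inv_inc_gf :: "nat \<Rightarrow> real fps" where
  "inv_inc_gf r \<equiv> inv_gf (\<lambda>n \<alpha>. \<not> has_inc n \<alpha> r)"

text \<open>The empty subsequence is always present, so nothing is counted for length 0.\<close>

lemma av_inc_gf_0: "av_inc_gf 0 = 0"
  by (rule fps_ext) (simp add: av_gf_def has_inc_0)

lemma inv_inc_gf_0: "inv_inc_gf 0 = 0"
  by (rule fps_ext) (simp add: inv_gf_def has_inc_0)

lemma not_has_inc_empty: "\<not> has_inc 0 \<alpha> (Suc r)"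
  by (auto simp: has_inc_def)

lemma filter_Times:
  "{x \<in> A \<times> B. P (fst x) \<and> Q (snd x)} = {x \<in> A. P x} \<times> {y \<in> B. Q y}"
  by auto

text \<open>The first block ends in its maximum, so \<open>L\<close> may only have increasing
  subsequences shorter than \<open>r\<close>, while the bound \<open>Suc r\<close> stays in force
  for the second block. The factor \<open>fps_X\<close> counts the maximum.\<close>

lemma av_inc_gf_Suc: "av_inc_gf (Suc r) = 1 + fps_X * (av_inc_gf r * av_inc_gf (Suc r))"
proof (rule fps_ext)
  fix n
  show "av_inc_gf (Suc r) $ n = (1 + fps_X * (av_inc_gf r * av_inc_gf (Suc r))) $ n"
  proof (cases n)
    case 0
    have "{\<alpha> \<in> av132 0. \<not> has_inc 0 \<alpha> (Suc r)} = {id}"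
      by (auto simp: av132_0 not_has_inc_empty)
    then show ?thesis using 0 by (simp add: av_gf_def)
  next
    case (Suc k)
    have "card {x \<in> av132 a \<times> av132 (k - a). \<not> has_inc (Suc k) (skew (Suc a) (fst x) (k - a) (snd x)) (Suc r)} =
        card {\<alpha> \<in> av132 a. \<not> has_inc a \<alpha> r} * card {\<alpha> \<in> av132 (k - a). \<not> has_inc (k - a) \<alpha> (Suc r)}"
      if "a \<in> {0..k}" for a
    proof -
      have "has_inc (Suc k) (skew (Suc a) L (k - a) R) (Suc r) \<longleftrightarrow> has_inc a L r \<or> has_inc (k - a) R (Suc r)"
        if "L \<in> av132 a" "R \<in> av132 (k - a)" for L R
        using has_inc_skew[of L "Suc a" R "k - a" "Suc r"] that \<open>a \<in> {0..k}\<close>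
          av132_permutes[OF conjunct1[OF av132_Suc[OF that(1)]]] av132_permutes[OF that(2)]
          has_inc_Suc_fixed[OF av132_permutes[OF that(1)], of r] by simp
      then have "{x \<in> av132 a \<times> av132 (k - a). \<not> has_inc (Suc k) (skew (Suc a) (fst x) (k - a) (snd x)) (Suc r)} =
          {x \<in> av132 a \<times> av132 (k - a). \<not> has_inc a (fst x) r \<and> \<not> has_inc (k - a) (snd x) (Suc r)}"
        by auto
      also have "\<dots> = {\<alpha> \<in> av132 a. \<not> has_inc a \<alpha> r} \<times> {\<alpha> \<in> av132 (k - a). \<not> has_inc (k - a) \<alpha> (Suc r)}"
        by (rule filter_Times)
      finally show ?thesis by (simp only: card_cartesian_product)
    qed
    then have "av_inc_gf (Suc r) $ n = (av_inc_gf r * av_inc_gf (Suc r)) $ k"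
      unfolding fps_mult_nth Suc by (simp add: av_gf_def card_av132_Suc)
    then show ?thesis using Suc by simp
  qed
qed

lemma has_inc_skew3:
  assumes "L \<in> av132 a" "M \<in> inv132 m"
  shows "has_inc (Suc a + (m + Suc a)) (skew3 a L m M) r \<longleftrightarrow> has_inc (Suc a) L r \<or> has_inc m M r"
proof -
  have L: "L permutes {1..Suc a}" and M: "M permutes {1..m}"
    using assms av132_Suc av132_permutes inv132_permutes by blast+
  note L' = permutes_inv[OF L]
  show ?thesis unfolding skew3_def has_inc_skew[OF L skew_permutes[OF M L']] has_inc_skew[OF M L']
      has_inc_inv_iff[OF L] by blast
qed

text \<open>If \<open>L\<close> has an increasing subsequence of length \<open>p \<ge> d\<close>,
  the outer blocks alone contain the pattern; this absorbs every occurrence inside an outer block or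
  with its upper part in the first block. What remains lies inside \<open>M\<close>, or has its
  upper part in \<open>M\<close> and its lower part in the last block.\<close>

lemma has_inc_inc_skew3:
  assumes "L \<in> av132 a" "M \<in> inv132 m" and pd: "p \<ge> d" "d \<ge> 1"
  shows "has_inc_inc (Suc a + (m + Suc a)) (skew3 a L m M) p d \<longleftrightarrow>
    has_inc (Suc a) L p \<or> has_inc_inc m M p d \<or> has_inc m M p \<and> has_inc (Suc a) L d"
proof -
  have L: "L permutes {1..Suc a}" and M: "M permutes {1..m}"
    using assms av132_Suc av132_permutes inv132_permutes by blast+
  note L' = permutes_inv[OF L]
  have p: "p \<ge> 1" using pd by simp
  have "has_inc (Suc a) L p \<Longrightarrow> has_inc (Suc a) L d" using pd(1) has_inc_antimono by blast
  moreover have "has_inc_inc (Suc a) L p d \<Longrightarrow> has_inc (Suc a) L p"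
    by (rule has_inc_inc_imp_has_inc)
  moreover have "has_inc_inc (Suc a) (inv L) p d \<Longrightarrow> has_inc (Suc a) L p"
    using has_inc_inc_imp_has_inc(1) has_inc_inv_iff[OF L] by blast
  ultimately show ?thesis
    unfolding skew3_def has_inc_inc_skew[OF L skew_permutes[OF M L'] p pd(2)]
      has_inc_inc_skew[OF M L' p pd(2)] has_inc_skew[OF M L'] has_inc_inv_iff[OF L] by blast
qed

text \<open>A fixed last maximum lowers the admissible length by one, and so does the maximum that
  ends the first block. The last block imposes no further condition, since inversion preserves
  increasing subsequences.\<close>

lemma inv_inc_gf_Suc:
  "inv_inc_gf (Suc r) = 1 + fps_X * inv_inc_gf r + fps_X^2 * ((av_inc_gf r oo fps_X^2) * inv_inc_gf (Suc r))"
proof -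
  have "real (card {x \<in> av132 a \<times> inv132 m. \<not> has_inc (Suc a + (m + Suc a)) (skew3 a (fst x) m (snd x)) (Suc r)}) =
      av_inc_gf r $ a * inv_inc_gf (Suc r) $ m" for a m
  proof -
    have "{x \<in> av132 a \<times> inv132 m. \<not> has_inc (Suc a + (m + Suc a)) (skew3 a (fst x) m (snd x)) (Suc r)} =
        {x \<in> av132 a \<times> inv132 m. \<not> has_inc a (fst x) r \<and> \<not> has_inc m (snd x) (Suc r)}"
      using has_inc_skew3[of _ a _ m "Suc r"] has_inc_Suc_fixed[OF av132_permutes] by fastforce
    also have "\<dots> = {\<alpha> \<in> av132 a. \<not> has_inc a \<alpha> r} \<times> {\<alpha> \<in> inv132 m. \<not> has_inc m \<alpha> (Suc r)}"
      by (rule filter_Times)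
    finally show ?thesis by (simp add: card_cartesian_product av_gf_def inv_gf_def)
  qed
  from inv_gf_rec[of "\<lambda>n \<alpha>. \<not> has_inc n \<alpha> (Suc r)" "\<lambda>n \<alpha>. \<not> has_inc n \<alpha> r", OF _ _ this]
  show ?thesis
    by (simp add: not_has_inc_empty has_inc_Suc_fixed Abs_fps_compose_X2_mult)
qed

lemma involution_gf_eq:
  assumes "d \<le> k"
  shows "involution_gf k d = inv_gf (\<lambda>n \<alpha>. \<not> has_inc_inc n \<alpha> (k - d) d)"
proof -
  have "avoiding_involutions k d n = {\<alpha> \<in> inv132 n. \<not> has_inc_inc n \<alpha> (k - d) d}" for n
    unfolding avoiding_involutions_def inv132_def av132_def contains_132_iff contains_kd_iff[OF assms]
    by blast
  then show ?thesis by (simp add: involution_gf_def inv_gf_def)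
qed

text \<open>The parts have lengths \<open>Suc p\<close> and \<open>Suc d\<close>, so that stripping
  the last entry of the first block leaves conditions on \<open>L\<close> with \<open>p\<close> and
  \<open>d\<close>. A fixed last maximum takes no part in the pattern, whence the term
  \<open>fps_X * I\<close>.\<close>

lemma inv_inc_inc_gf_rec:
  fixes p d :: nat
  assumes "d \<le> p"
  defines "I \<equiv> inv_gf (\<lambda>n \<alpha>. \<not> has_inc_inc n \<alpha> (Suc p) (Suc d))"
  shows "I = 1 + fps_X * I + fps_X^2 * ((av_inc_gf d oo fps_X^2) * I +
      ((av_inc_gf p oo fps_X^2) - (av_inc_gf d oo fps_X^2)) * inv_inc_gf (Suc p))"
proof -
  have "real (card {x \<in> av132 a \<times> inv132 m.
        \<not> has_inc_inc (Suc a + (m + Suc a)) (skew3 a (fst x) m (snd x)) (Suc p) (Suc d)}) =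
      av_inc_gf d $ a * I $ m + (av_inc_gf p - av_inc_gf d) $ a * inv_inc_gf (Suc p) $ m" for a m
  proof -
    let ?Ad = "{\<alpha> \<in> av132 a. \<not> has_inc a \<alpha> d}" and ?Ap = "{\<alpha> \<in> av132 a. \<not> has_inc a \<alpha> p}"
    let ?I = "{\<alpha> \<in> inv132 m. \<not> has_inc_inc m \<alpha> (Suc p) (Suc d)}"
    let ?J = "{\<alpha> \<in> inv132 m. \<not> has_inc m \<alpha> (Suc p)}"
    have sub: "?Ad \<subseteq> ?Ap" using has_inc_antimono[of a _ p d] assms(1) by blast
    have JI: "?J \<subseteq> ?I" using has_inc_inc_imp_has_inc(1) by blast
    have fin: "finite ?Ad" "finite ?Ap" "finite ?I" "finite ?J"
      using finite_av132 finite_inv132 by simp_all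
    have iff: "has_inc_inc (Suc a + (m + Suc a)) (skew3 a L m M) (Suc p) (Suc d) \<longleftrightarrow>
        has_inc a L p \<or> has_inc_inc m M (Suc p) (Suc d) \<or> has_inc m M (Suc p) \<and> has_inc a L d"
      if "L \<in> av132 a" "M \<in> inv132 m" for L M
      using has_inc_inc_skew3[OF that, of "Suc d" "Suc p"] assms(1)
        has_inc_Suc_fixed[OF av132_permutes[OF that(1)]] by simp
    \<comment> \<open>A disjoint split: if \<open>L\<close> has no increasing subsequence of length
      \<open>d\<close>, then \<open>M\<close> only has to avoid the pattern; otherwise
      \<open>M\<close> may have no increasing subsequence of length \<open>Suc p\<close>.\<close>
    have "{x \<in> av132 a \<times> inv132 m.
        \<not> has_inc_inc (Suc a + (m + Suc a)) (skew3 a (fst x) m (snd x)) (Suc p) (Suc d)} =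
      ?Ad \<times> ?I \<union> (?Ap - ?Ad) \<times> ?J" (is "?S = _")
    proof (rule set_eqI)
      fix x :: "(nat \<Rightarrow> nat) \<times> (nat \<Rightarrow> nat)"
      obtain L M where x: "x = (L, M)" by force
      show "x \<in> ?S \<longleftrightarrow> x \<in> ?Ad \<times> ?I \<union> (?Ap - ?Ad) \<times> ?J"
      proof (cases "L \<in> av132 a \<and> M \<in> inv132 m")
        case True
        then have LM: "L \<in> av132 a" "M \<in> inv132 m" by simp_all
        have "has_inc a L p \<Longrightarrow> has_inc a L d" using has_inc_antimono assms(1) by blast
        \<comment> \<open>Hence in the second piece the bound on increasing subsequences of
          \<open>M\<close> already excludes the pattern from \<open>M\<close>.\<close>
        moreover have "has_inc_inc m M (Suc p) (Suc d) \<Longrightarrow> has_inc m M (Suc p)"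
          by (rule has_inc_inc_imp_has_inc)
        ultimately show ?thesis
          unfolding x mem_Collect_eq fst_conv snd_conv mem_Times_iff Un_iff Diff_iff iff[OF LM]
          using LM by blast
      qed (auto simp: x)
    qed
    moreover have "(?Ad \<times> ?I) \<inter> ((?Ap - ?Ad) \<times> ?J) = {}" by blast
    ultimately have "card ?S = card ?Ad * card ?I + card (?Ap - ?Ad) * card ?J"
      using fin by (simp only: card_Un_disjoint finite_cartesian_product finite_Diff card_cartesian_product)
    also have "card (?Ap - ?Ad) = card ?Ap - card ?Ad" using sub fin(1) by (simp add: card_Diff_subset)
    finally show ?thesis
      using card_mono[OF fin(2) sub] by (simp add: av_gf_def inv_gf_def I_def of_nat_diff)
  qed
  note product = this
  have empty: "\<not> has_inc_inc 0 id (Suc p) (Suc d)"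
    using has_inc_inc_imp_has_inc(1) not_has_inc_empty by blast
  have fixed: "\<not> has_inc_inc (Suc n) \<alpha> (Suc p) (Suc d) \<longleftrightarrow> \<not> has_inc_inc n \<alpha> (Suc p) (Suc d)"
    if "\<alpha> permutes {1..n}" for n \<alpha>
    using has_inc_inc_Suc_fixed[OF that, of "Suc p" "Suc d"] by simp
  have "I = 1 + fps_X * I + fps_X^2 * Abs_fps (\<lambda>n. \<Sum>a | 2 * a \<le> n. av_inc_gf d $ a * I $ (n - 2 * a) +
      (av_inc_gf p - av_inc_gf d) $ a * inv_inc_gf (Suc p) $ (n - 2 * a))"
    using inv_gf_rec[of "\<lambda>n \<alpha>. \<not> has_inc_inc n \<alpha> (Suc p) (Suc d)", OF empty fixed product]
    unfolding I_def .
  also have "Abs_fps (\<lambda>n. \<Sum>a | 2 * a \<le> n. av_inc_gf d $ a * I $ (n - 2 * a) +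
      (av_inc_gf p - av_inc_gf d) $ a * inv_inc_gf (Suc p) $ (n - 2 * a)) =
      (av_inc_gf d oo fps_X^2) * I + ((av_inc_gf p - av_inc_gf d) oo fps_X^2) * inv_inc_gf (Suc p)"
    unfolding Abs_fps_compose_X2_mult[symmetric] by (rule fps_ext) (simp add: sum.distrib)
  finally show ?thesis by (simp only: fps_compose_sub_distrib)
qed

section \<open>Evaluation by Chebyshev polynomials\<close>

text \<open>The polynomial recurrence is carried over coefficientwise; besides the difference, only
  multiplication by \<open>[:0, 2:]\<close> has to be traced through
  \<open>map_poly fls_const\<close>.\<close>

lemma chebU_rec: "chebU (r + 1) t = 2 * t * chebU r t - chebU (r - 1) t"
proof -
  have diff: "map_poly fls_const (p - q) = map_poly fls_const p - map_poly fls_const q"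
    for p q :: "real poly"
    by (intro poly_eqI fls_eqI) (simp add: coeff_map_poly)
  have "map_poly fls_const ([:0, 2:] * p) = pCons 0 (smult 2 (map_poly fls_const p))"
    for p :: "real poly"
    by (rule poly_eqI)
      (simp add: coeff_map_poly coeff_pCons fls_const_mult_const[symmetric] del: fls_const_mult_const split: nat.split)
  then show ?thesis unfolding chebU_def chebyshev_U_rec diff by simp
qed

lemma chebU_minus_1: "chebU (-1) t = 0"
  by (simp add: chebU_def chebyshev_U_minus_1)

lemma chebU_0: "chebU 0 t = 1"
  by (simp add: chebU_def chebyshev_U_0)

text \<open>The shift by one brings the index -1 into the natural numbers, so that the recurrence
  starts from the values 0 and 1.\<close>

definition shifted_U :: "nat \<Rightarrow> real fls" where
  "shifted_U n = chebU (int n - 1) (1 / (2 * fls_X))"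

text \<open>At this \<open>t\<close> one has \<open>2 * t * fls_X = 1\<close>, so multiplying the
  Chebyshev recurrence by \<open>fls_X\<close> clears the denominator.\<close>

lemma shifted_U_simps:
  "shifted_U 0 = 0" "shifted_U (Suc 0) = 1"
  "fls_X * shifted_U (Suc (Suc n)) = shifted_U (Suc n) - fls_X * shifted_U n"
proof -
  define t :: "real fls" where "t = 1 / (2 * fls_X)"
  have "x * (2 * (1 / (2 * x)) * c) = c" if "x \<noteq> 0" for x c :: "real fls"
    using that by (simp add: field_simps)
  from this[of fls_X] have "fls_X * (2 * t * c) = c" for c
    unfolding t_def by simp
  then show "fls_X * shifted_U (Suc (Suc n)) = shifted_U (Suc n) - fls_X * shifted_U n"
    using chebU_rec[of "int n" t]
    by (simp add: shifted_U_def t_def[symmetric] right_diff_distrib add.commute)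
qed (simp_all add: shifted_U_def chebU_minus_1 chebU_0)

text \<open>A d'Ocagne type identity: by the recurrence the cross product is unchanged when both
  indices drop by one, and at \<open>m = 0\<close> it is \<open>shifted_U n\<close>.\<close>

lemma shifted_U_cross:
  assumes "m \<le> n"
  shows "shifted_U n * shifted_U (Suc m) - shifted_U m * shifted_U (Suc n) = shifted_U (n - m)"
  using assms
proof (induction m arbitrary: n)
  case 0
  then show ?case by (simp add: shifted_U_simps)
next
  case (Suc m)
  then obtain l where n: "n = Suc l" "m \<le> l" by (cases n) auto
  have "fls_X * (shifted_U n * shifted_U (Suc (Suc m)) - shifted_U (Suc m) * shifted_U (Suc n)) =
      shifted_U n * (fls_X * shifted_U (Suc (Suc m))) - shifted_U (Suc m) * (fls_X * shifted_U (Suc (Suc l)))"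
    using n by (simp add: algebra_simps)
  also have "\<dots> = fls_X * (shifted_U l * shifted_U (Suc m) - shifted_U m * shifted_U (Suc l))"
    unfolding shifted_U_simps using n by (simp add: algebra_simps)
  also have "\<dots> = fls_X * shifted_U (l - m)" using Suc.IH[OF n(2)] by simp
  finally show ?case using n by simp
qed

section \<open>Solving the recurrences among Laurent series\<close>

definition av_fls :: "nat \<Rightarrow> real fls" where
  "av_fls r = fps_to_fls (av_inc_gf r oo fps_X^2)"

definition inv_fls :: "nat \<Rightarrow> real fls" where
  "inv_fls r = fps_to_fls (inv_inc_gf r)"

lemma av_fls_0: "av_fls 0 = 0"
  by (simp add: av_fls_def av_inc_gf_0)

text \<open>The recurrence at \<open>fls_X^2\<close>, rearranged to exhibit the factor that also
  multiplies the unknown in the recurrences for involutions.\<close>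

lemma av_fls_Suc: "av_fls (Suc r) * (1 - fls_X^2 * av_fls r) = 1"
proof -
  have "av_inc_gf (Suc r) oo fps_X^2 = 1 + fps_X^2 * ((av_inc_gf r oo fps_X^2) * (av_inc_gf (Suc r) oo fps_X^2))"
    by (subst av_inc_gf_Suc) (simp add: fps_compose_add_distrib fps_compose_mult_distrib)
  from arg_cong[OF this, of fps_to_fls]
  have "av_fls (Suc r) = 1 + fls_X^2 * (av_fls r * av_fls (Suc r))"
    unfolding av_fls_def by (simp add: fls_times_fps_to_fls fps_to_fls_power)
  then show ?thesis by (simp add: algebra_simps)
qed

lemma inv_fls_Suc: "inv_fls (Suc r) * (1 - fls_X^2 * av_fls r) = 1 + fls_X * inv_fls r"
proof -
  from arg_cong[OF inv_inc_gf_Suc[of r], of fps_to_fls]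
  have "inv_fls (Suc r) = 1 + fls_X * inv_fls r + fls_X^2 * (av_fls r * inv_fls (Suc r))"
    unfolding av_fls_def inv_fls_def by (simp add: fls_times_fps_to_fls fps_to_fls_power)
  then show ?thesis by (simp add: algebra_simps)
qed

text \<open>The continued fraction for \<open>av_fls\<close> and the three-term recurrence have the
  same convergents. Non-vanishing is part of the induction: the product on the left equals the
  previous, nonzero term, so its last factor is nonzero.\<close>

lemma shifted_U_av_fls:
  "shifted_U (Suc r) \<noteq> 0 \<and> fls_X * av_fls r * shifted_U (Suc r) = shifted_U r"
proof (induction r)
  case 0
  then show ?case by (simp add: shifted_U_simps av_fls_0)
next
  case (Suc r)
  have *: "fls_X * shifted_U (Suc (Suc r)) = shifted_U (Suc r) * (1 - fls_X^2 * av_fls r)"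
    unfolding shifted_U_simps using Suc by (simp add: algebra_simps power2_eq_square)
  have "fls_X * av_fls (Suc r) * shifted_U (Suc (Suc r)) = av_fls (Suc r) * (fls_X * shifted_U (Suc (Suc r)))"
    by simp
  also have "\<dots> = shifted_U (Suc r) * (av_fls (Suc r) * (1 - fls_X^2 * av_fls r))"
    unfolding * by (rule mult.left_commute)
  also have "\<dots> = shifted_U (Suc r)" by (simp only: av_fls_Suc mult_1_right)
  finally show ?case using Suc by auto
qed

lemma shifted_U_Suc_nonzero: "shifted_U (Suc r) \<noteq> 0"
  using shifted_U_av_fls by blast

lemma X_shifted_U_Suc_Suc: "fls_X * shifted_U (Suc (Suc r)) = shifted_U (Suc r) * (1 - fls_X^2 * av_fls r)"
  unfolding shifted_U_simps using shifted_U_av_fls[of r] by (simp add: algebra_simps power2_eq_square)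

text \<open>Multiplied by \<open>shifted_U (Suc p)\<close>, the recurrence
  \<open>inv_fls_Suc\<close> adds exactly one Chebyshev term at each step, so it sums up.\<close>

lemma inv_fls_eq: "fls_X * shifted_U (Suc p) * inv_fls p = (\<Sum>i<p. shifted_U (Suc i))"
proof (induction p)
  case 0
  then show ?case by (simp add: inv_fls_def inv_inc_gf_0)
next
  case (Suc p)
  have "fls_X * shifted_U (Suc (Suc p)) * inv_fls (Suc p) =
      shifted_U (Suc p) * (inv_fls (Suc p) * (1 - fls_X^2 * av_fls p))"
    unfolding X_shifted_U_Suc_Suc by (simp add: algebra_simps)
  also have "\<dots> = shifted_U (Suc p) + fls_X * shifted_U (Suc p) * inv_fls p"
    unfolding inv_fls_Suc by (simp add: algebra_simps)
  finally show ?case using Suc by simp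
qed

text \<open>Makes the main denominator nonzero. Equality would annihilate the power series
  \<open>1 - fps_X - fps_X^2 * (av_inc_gf r oo fps_X^2)\<close>, whose constant term is 1.\<close>

lemma shifted_U_Suc_Suc_neq: "shifted_U (Suc (Suc r)) \<noteq> shifted_U (Suc r)"
proof
  assume "shifted_U (Suc (Suc r)) = shifted_U (Suc r)"
  then have "shifted_U (Suc r) * (1 - fls_X - fls_X^2 * av_fls r) = 0"
    using X_shifted_U_Suc_Suc[of r] by (simp add: algebra_simps)
  then have "1 - fls_X - fls_X^2 * av_fls r = 0" using shifted_U_Suc_nonzero by simp
  moreover have "1 - fls_X - fls_X^2 * av_fls r = fps_to_fls (1 - fps_X - fps_X^2 * (av_inc_gf r oo fps_X^2))"
    by (simp add: av_fls_def fls_times_fps_to_fls fps_to_fls_power)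
  ultimately have "1 - fps_X - fps_X^2 * (av_inc_gf r oo fps_X^2) = 0" by (simp del: fps_to_fls_minus)
  then have "(1 - fps_X - fps_X^2 * (av_inc_gf r oo fps_X^2)) $ 0 = 0" by simp
  then show False by simp
qed

theorem theorem2p13:
  fixes k d :: nat and t :: "real fls"
  assumes "k \<ge> 2" and "real k / 2 \<ge> real d" and "d \<ge> 1"
    and "t = 1 / (2 * fls_X)"
  shows "fps_to_fls (involution_gf k d) =
    1 / (fls_X * (chebU (int d) t - chebU (int d - 1) t)) *
      (chebU (int d - 1) t +
       chebU (int k - 2 * int d - 1) t / (chebU (int k - int d) t * chebU (int k - int d - 1) t) *
         (\<Sum>j = 0..int k - int d - 1. chebU j t))"
proof -
  have "2 * d \<le> k" using assms(2) by linarith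
  \<comment> \<open>The lengths \<open>d\<close> and \<open>k - d\<close> become
    \<open>Suc e\<close> and \<open>Suc p\<close>, the form of the recurrence;
    \<open>e \<le> p\<close> expresses \<open>2 * d \<le> k\<close>.\<close>
  define e where "e = d - 1"
  define p where "p = k - d - 1"
  have d: "d = Suc e" and k: "k = Suc p + Suc e" and ep: "e \<le> p"
    using \<open>2 * d \<le> k\<close> assms(1,3) by (simp_all add: e_def p_def)
  have U: "chebU (int d) t = shifted_U (Suc (Suc e))" "chebU (int d - 1) t = shifted_U (Suc e)"
    "chebU (int k - 2 * int d - 1) t = shifted_U (p - e)"
    "chebU (int k - int d) t = shifted_U (Suc (Suc p))"
    "chebU (int k - int d - 1) t = shifted_U (Suc p)"
    unfolding shifted_U_def assms(4) using ep
    by (simp_all add: d k of_nat_diff algebra_simps)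
  \<comment> \<open>The integer summation index is turned into a natural one, with
    \<open>chebU\<close> at \<open>j\<close> equal to \<open>shifted_U\<close> at
    \<open>j + 1\<close>.\<close>
  have "(\<Sum>j = 0..int k - int d - 1. chebU j t) = (\<Sum>i<Suc p. shifted_U (Suc i))"
    by (rule sum.reindex_bij_witness[of _ int nat]) (auto simp: shifted_U_def assms(4) d k)
  then have S: "(\<Sum>j = 0..int k - int d - 1. chebU j t) = fls_X * shifted_U (Suc (Suc p)) * inv_fls (Suc p)"
    by (simp only: inv_fls_eq)
  define I where "I = fps_to_fls (involution_gf k d)"
  have "involution_gf k d = inv_gf (\<lambda>n \<alpha>. \<not> has_inc_inc n \<alpha> (Suc p) (Suc e))"
    using involution_gf_eq[of d k] by (simp add: d k)
  from arg_cong[OF inv_inc_inc_gf_rec[OF ep], of fps_to_fls, folded this]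
  have "I = 1 + fls_X * I + fls_X^2 * (av_fls e * I + (av_fls p - av_fls e) * inv_fls (Suc p))"
    unfolding I_def av_fls_def inv_fls_def by (simp add: fls_times_fps_to_fls fps_to_fls_power)
  then have rec: "I * ((1 - fls_X^2 * av_fls e) - fls_X) = 1 + fls_X^2 * (av_fls p - av_fls e) * inv_fls (Suc p)"
    by (simp add: algebra_simps)
  have e: "fls_X * av_fls e * shifted_U (Suc e) = shifted_U e"
    and p: "fls_X * av_fls p * shifted_U (Suc p) = shifted_U p"
    using shifted_U_av_fls by blast+
  \<comment> \<open>Multiplying the recurrence by \<open>shifted_U (Suc e)\<close> turns
    \<open>1 - fls_X^2 * av_fls e\<close> into \<open>fls_X * shifted_U (Suc (Suc e))\<close> and so
    produces the denominator of the claim.\<close>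
  have "I * (fls_X * (shifted_U (Suc (Suc e)) - shifted_U (Suc e))) =
      shifted_U (Suc e) * (I * ((1 - fls_X^2 * av_fls e) - fls_X))"
    unfolding right_diff_distrib[of fls_X] X_shifted_U_Suc_Suc by (simp add: algebra_simps)
  also have "\<dots> = shifted_U (Suc e) +
      (fls_X * av_fls p * shifted_U (Suc e) - fls_X * av_fls e * shifted_U (Suc e)) * (fls_X * inv_fls (Suc p))"
    unfolding rec by (simp add: algebra_simps power2_eq_square)
  \<comment> \<open>Writing both series as Chebyshev quotients leaves a cross product in the
    numerator, which collapses to \<open>shifted_U (p - e)\<close>.\<close>
  also have "fls_X * av_fls p * shifted_U (Suc e) - fls_X * av_fls e * shifted_U (Suc e) =
      (shifted_U p * shifted_U (Suc e) - shifted_U e * shifted_U (Suc p)) / shifted_U (Suc p)"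
    unfolding e p[symmetric] using shifted_U_Suc_nonzero[of p] by (simp add: field_simps)
  also have "\<dots> = shifted_U (p - e) / shifted_U (Suc p)" unfolding shifted_U_cross[OF ep] ..
  finally have "I * (fls_X * (shifted_U (Suc (Suc e)) - shifted_U (Suc e))) =
      shifted_U (Suc e) + shifted_U (p - e) / shifted_U (Suc p) * (fls_X * inv_fls (Suc p))" .
  \<comment> \<open>The fraction is expanded by \<open>shifted_U (Suc (Suc p))\<close> so that the
    last factor becomes the sum in \<open>S\<close>.\<close>
  also have "\<dots> = shifted_U (Suc e) + shifted_U (p - e) / (shifted_U (Suc (Suc p)) * shifted_U (Suc p)) *
      (fls_X * shifted_U (Suc (Suc p)) * inv_fls (Suc p))"
    using shifted_U_Suc_nonzero[of "Suc p"] by simp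
  finally show ?thesis
    unfolding U S I_def[symmetric] using shifted_U_Suc_Suc_neq[of e]
    by (simp add: nonzero_eq_divide_eq)
qed

end
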